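(* Let $\tau>0$ be a constant and let $p=p(n)\in[0,1]$ satisfy $p(n)\gg\log(n)/n$, i.e. $\lim_{n\to\infty}\frac{n\,p(n)}{\log n}=\infty$. Let $L_n$ be the Laplacian matrix of the Erdős–Rényi random graph $G(n,p(n))$. Then the von Neumann entropy $S(\varrho_{L_n}^\tau)$ of the Gibbs state converges to zero asymptotically almost surely as $n\to\infty$; that is, for every $\varepsilon>0$, $\Pr\big(S(\varrho_{L_n}^\tau)<\varepsilon\big)\to1$ as $n\to\infty$.
   Context: The Erdős–Rényi random graph $G(n,p)$ is the random simple undirected graph on $n$ vertices in which each pair of distinct vertices is adjacent independently with probability $p$. The Laplacian of a simple graph is $L=D-A$, where $A$ is the adjacency matrix and $D$ the diagonal matrix of vertex degrees. For a Hermitian matrix $H$ and real $\tau$, the Gibbs state is $\varrho_H^\tau=\exp(-\tau H)/Z$ with $Z=\mathrm{Tr}(\exp(-\tau H))$. The von Neumann entropy of a density matrix $\varrho$ is $S(\varrho)=-\mathrm{Tr}(\varrho\log\varrho)$, where $\log$ is the natural logarithm. *)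

theory Defs
  imports "HOL-Probability.Probability" "Jordan_Normal_Form.Schur_Decomposition"
begin

text \<open>Graphs have vertex set \<open>{..<n}\<close> and are given by their edge set, a set of
  two-element subsets of \<open>{..<n}\<close>.\<close>

definition vertex_pairs :: "nat \<Rightarrow> nat set set" where
  "vertex_pairs n = {e. e \<subseteq> {..<n} \<and> card e = 2}"

definition erdos_renyi :: "nat \<Rightarrow> real \<Rightarrow> nat set set pmf" where
  "erdos_renyi n p =
     map_pmf (\<lambda>b. {e \<in> vertex_pairs n. b e})
       (Pi_pmf (vertex_pairs n) False (\<lambda>_. bernoulli_pmf p))"

definition adjacency_mat :: "nat \<Rightarrow> nat set set \<Rightarrow> complex mat" where
  "adjacency_mat n E = mat n n (\<lambda>(i, j). if {i, j} \<in> E then 1 else 0)"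

definition degree_mat :: "nat \<Rightarrow> nat set set \<Rightarrow> complex mat" where
  "degree_mat n E = mat_diag n (\<lambda>i. of_nat (card {j \<in> {..<n}. {i, j} \<in> E}))"

definition laplacian_mat :: "nat \<Rightarrow> nat set set \<Rightarrow> complex mat" where
  "laplacian_mat n E = degree_mat n E - adjacency_mat n E"

definition mat_trace :: "'a :: comm_monoid_add mat \<Rightarrow> 'a" where
  "mat_trace A = (\<Sum>i<dim_row A. A $$ (i, i))"

text \<open>The exponential power series of a square matrix, summed entrywise.\<close>

definition mat_exp :: "complex mat \<Rightarrow> complex mat" where
  "mat_exp A = mat (dim_row A) (dim_row A) (\<lambda>(i, j). \<Sum>k. (A ^\<^sub>m k) $$ (i, j) / fact k)"

definition gibbs_state :: "real \<Rightarrow> complex mat \<Rightarrow> complex mat" where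
  "gibbs_state \<tau> H =
     (let X = mat_exp (complex_of_real (- \<tau>) \<cdot>\<^sub>m H) in (1 / mat_trace X) \<cdot>\<^sub>m X)"

definition unitary_mat :: "complex mat \<Rightarrow> bool" where
  "unitary_mat U \<longleftrightarrow> square_mat U \<and> U * mat_adjoint U = 1\<^sub>m (dim_row U)
     \<and> mat_adjoint U * U = 1\<^sub>m (dim_row U)"

text \<open>\<open>spectral_form n A U d\<close>: the unitary diagonalisation
  \<open>A = U diag(d\<^sub>0, \<dots>, d\<^sub>n\<^sub>-\<^sub>1) U\<^sup>*\<close> with real eigenvalues,
  which exists exactly for the Hermitian matrices \<open>A\<close> of size \<open>n\<close>.\<close>

definition spectral_form :: "nat \<Rightarrow> complex mat \<Rightarrow> complex mat \<Rightarrow> (nat \<Rightarrow> real) \<Rightarrow> bool" where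
  "spectral_form n A U d \<longleftrightarrow> U \<in> carrier_mat n n \<and> unitary_mat U
     \<and> A = U * mat_diag n (\<lambda>i. complex_of_real (d i)) * mat_adjoint U"

text \<open>Functional calculus of a Hermitian matrix: \<open>f\<close> is applied to the eigenvalues. The result
  does not depend on the diagonalisation (\<open>hermitian_fun_eq\<close> below).\<close>

definition hermitian_fun :: "(real \<Rightarrow> real) \<Rightarrow> complex mat \<Rightarrow> complex mat" where
  "hermitian_fun f A =
     (THE B. \<exists>U d. spectral_form (dim_row A) A U d \<and> spectral_form (dim_row A) B U (f \<circ> d))"

text \<open>Since \<open>ln 0 = 0\<close>, a zero eigenvalue of \<open>\<rho>\<close> contributes \<open>0\<close>,
  the usual convention \<open>0 log 0 = 0\<close>. The trace is real, so \<open>Re\<close> only changes the type.\<close>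

definition von_neumann_entropy :: "complex mat \<Rightarrow> real" where
  "von_neumann_entropy \<rho> = - Re (mat_trace (\<rho> * hermitian_fun ln \<rho>))"

lemma mat_adjoint_carrier:
  assumes "U \<in> carrier_mat n n"
  shows "mat_adjoint U \<in> carrier_mat n n"
  using assms by (auto simp: mat_adjoint_def)

lemma spectral_form_unique:
  assumes U: "spectral_form n A U d" and V: "spectral_form n A V e"
    and B: "spectral_form n B U (f \<circ> d)" and C: "spectral_form n C V (f \<circ> e)"
  shows "B = C"
proof -
  let ?D = "\<lambda>d. mat_diag n (\<lambda>i. complex_of_real (d i))"
  let ?U = "mat_adjoint U" and ?V = "mat_adjoint V"
  have c: "U \<in> carrier_mat n n" "V \<in> carrier_mat n n" "?U \<in> carrier_mat n n"
    "?V \<in> carrier_mat n n" "\<And>d. ?D d \<in> carrier_mat n n"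
    using U V by (auto simp: spectral_form_def mat_adjoint_carrier)
  have inv: "U * ?U = 1\<^sub>m n" "?U * U = 1\<^sub>m n" "V * ?V = 1\<^sub>m n" "?V * V = 1\<^sub>m n"
    using U V by (auto simp: spectral_form_def unitary_mat_def)
  note mc = mult_carrier_mat[of _ n n _ n]
  have assoc: "X * Y * Z = X * (Y * Z)"
    if "X \<in> carrier_mat n n" "Y \<in> carrier_mat n n" "Z \<in> carrier_mat n n" for X Y Z :: "complex mat"
    using that by (rule assoc_mult_mat)
  define W where "W = ?V * U"
  have W: "W \<in> carrier_mat n n" using c by (auto simp: W_def)
  have conj: "W * ?D a = ?D b * W \<longleftrightarrow> U * ?D a * ?U = V * ?D b * ?V" for a b
  proof
    assume *: "W * ?D a = ?D b * W"
    have "U * ?D a * ?U = (V * ?V) * (U * ?D a * ?U)"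
      unfolding inv using c
      by (simp add: mc right_mult_one_mat[of _ n n] left_mult_one_mat[of _ n n])
    also have "\<dots> = V * (W * ?D a) * ?U"
      unfolding W_def using c by (simp add: assoc mc)
    also have "\<dots> = V * ?D b * ?V * (U * ?U)"
      unfolding * unfolding W_def
      using c by (simp add: assoc mc)
    also have "\<dots> = V * ?D b * ?V" unfolding inv using c
      by (simp add: mc right_mult_one_mat[of _ n n] left_mult_one_mat[of _ n n])
    finally show "U * ?D a * ?U = V * ?D b * ?V" .
  next
    assume *: "U * ?D a * ?U = V * ?D b * ?V"
    have "W * ?D a = ?V * U * ?D a * (?U * U)" unfolding W_def inv using c
      by (simp add: mc right_mult_one_mat[of _ n n] left_mult_one_mat[of _ n n])
    also have "\<dots> = ?V * (U * ?D a * ?U) * U"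
      using c by (simp add: assoc mc)
    also have "\<dots> = (?V * V) * ?D b * W" unfolding * W_def
      using c by (simp add: assoc mc)
    also have "\<dots> = ?D b * W" unfolding inv using c
      by (simp add: mc right_mult_one_mat[of _ n n] left_mult_one_mat[of _ n n])
    finally show "W * ?D a = ?D b * W" .
  qed
  have entry: "W * ?D a = ?D b * W \<longleftrightarrow>
      (\<forall>i<n. \<forall>j<n. W $$ (i, j) * complex_of_real (a j) = complex_of_real (b i) * W $$ (i, j))" for a b
    using W by (auto simp: mat_diag_mult_left[OF W] mat_diag_mult_right[OF W] mat_eq_iff)
  have "W * ?D d = ?D e * W"
    using U V by (simp add: conj spectral_form_def)
  then have "W * ?D (f \<circ> d) = ?D (f \<circ> e) * W"
    unfolding entry by (fastforce simp: mult.commute)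
  then show ?thesis
    using B C by (simp add: conj spectral_form_def)
qed

lemma hermitian_fun_eq:
  assumes "spectral_form n A U d" "spectral_form n B U (f \<circ> d)"
  shows "hermitian_fun f A = B"
proof -
  have "dim_row A = n" using assms(1) by (auto simp: spectral_form_def)
  then show ?thesis
    unfolding hermitian_fun_def using assms spectral_form_unique by (intro the_equality) blast+
qed

end

theory Submission
  imports Defs "Jordan_Normal_Form.Spectral_Radius" "HOL-Real_Asymp.Real_Asymp"
begin

text \<open>
  The Laplacian of a connected graph has a single zero eigenvalue, so its Gibbs state is nearly pure
  as soon as all other Boltzmann weights together are negligible. There are \<open>n - 1\<close> of them, hence it
  suffices that the spectral gap exceeds a large multiple of \<open>ln n\<close>. The quantitative form is
  \<open>gibbs_entropy_le\<close>: with gap \<open>g\<close> the entropy is at most \<open>2 n exp (- \<tau> g / 2)\<close>.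

  The gap of the random graph is bounded below by a constant multiple of the mean degree \<open>p n\<close>,
  which dominates \<open>ln n\<close> by assumption. This follows from Cheeger's inequality
  (\<open>cheeger_inequality\<close>), which reduces the gap to two combinatorial properties: every set \<open>S\<close> of
  at most \<open>n / 2\<close> vertices has at least \<open>p n \<bar>S\<bar> / 8\<close> boundary edges, and all degrees are at most
  \<open>3 p n\<close>. For a fixed set or vertex these are Chernoff bounds for sums of independent indicators.
  The failure probability of a set of size \<open>k\<close> is at most \<open>exp (- p n / 8) ^ k\<close>, so the union bound over
  all sets is \<open>(1 + exp (- p n / 8)) ^ n - 1\<close>, which tends to zero because
  \<open>exp (- p n / 8) \<le> 1 / n\<^sup>2\<close> eventually (\<open>prob_not_expanding\<close>).

  To relate the quadratic form of the Laplacian to the entropy, which is defined through matrix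
  exponential and functional calculus, everything is expressed in one orthonormal eigenbasis, whose
  existence is the spectral theorem \<open>hermitian_spectral_form\<close>. Its eigenvectors may be complex and
  come in no particular order; \<open>laplacian_spectral_gap\<close> identifies the zero eigenvalue by the overlap
  of its eigenvector with the all-ones vector.
\<close>

section \<open>The spectral theorem for Hermitian matrices\<close>

lemma mat_adjoint_dim [simp]: "dim_row (mat_adjoint A) = dim_col A" "dim_col (mat_adjoint A) = dim_row A"
  by (simp_all add: mat_adjoint_def)

lemma mat_adjoint_index [simp]:
  fixes A :: "complex mat"
  shows "i < dim_col A \<Longrightarrow> j < dim_row A \<Longrightarrow> mat_adjoint A $$ (i, j) = cnj (A $$ (j, i))"
  by (simp add: mat_adjoint_def mat_of_rows_def)

lemma mat_mult_index:
  assumes "A \<in> carrier_mat n m" "B \<in> carrier_mat m k" "i < n" "j < k"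
  shows "(A * B) $$ (i, j) = (\<Sum>l<m. A $$ (i, l) * B $$ (l, j))"
  using assms by (simp add: scalar_prod_def lessThan_atLeast0)

lemma mat_adjoint_mult:
  fixes A B :: "complex mat"
  assumes A: "A \<in> carrier_mat n m" and B: "B \<in> carrier_mat m k"
  shows "mat_adjoint (A * B) = mat_adjoint B * mat_adjoint A"
  by (rule eq_matI) (use A B in \<open>auto simp: scalar_prod_def mult.commute intro!: sum.cong\<close>)

lemma mat_adjoint_adjoint [simp]: "mat_adjoint (mat_adjoint A) = (A :: complex mat)"
  by (rule eq_matI) auto

lemma spectral_formI:
  assumes U: "U \<in> carrier_mat n n" and A: "A \<in> carrier_mat n n"
    and UU: "mat_adjoint U * U = 1\<^sub>m n"
    and AU: "A * U = U * mat_diag n (\<lambda>i. complex_of_real (d i))"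
  shows "spectral_form n A U d"
proof -
  have U': "mat_adjoint U \<in> carrier_mat n n" using U by (rule mat_adjoint_carrier)
  have UU': "U * mat_adjoint U = 1\<^sub>m n"
    using mat_mult_left_right_inverse[OF U' U UU] .
  have "A = A * (U * mat_adjoint U)" using A by (simp add: UU')
  also have "\<dots> = (A * U) * mat_adjoint U" using A U U' by simp
  finally have "A = U * mat_diag n (\<lambda>i. complex_of_real (d i)) * mat_adjoint U" by (simp only: AU)
  then show ?thesis using U UU UU' by (auto simp: spectral_form_def unitary_mat_def)
qed

text \<open>The first column of \<open>W\<close> is a normalised eigenvector. Completing that eigenvector to
  a basis and applying Gram-Schmidt leaves the first vector alone, so it only remains to rescale
  the resulting orthogonal vectors to unit length.\<close>

lemma unitary_first_eigenvector:
  fixes A :: "complex mat"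
  assumes A: "A \<in> carrier_mat n n" and n: "0 < n"
  obtains W e where "W \<in> carrier_mat n n" "mat_adjoint W * W = 1\<^sub>m n"
    "\<And>i. i < n \<Longrightarrow> (A * W) $$ (i, 0) = e * W $$ (i, 0)"
proof -
  obtain e where "eigenvalue A e"
    using spectrum_non_empty[OF A n] by (auto simp: spectrum_def)
  then obtain v where v: "v \<in> carrier_vec n" "v \<noteq> 0\<^sub>v n" "A *\<^sub>v v = e \<cdot>\<^sub>v v"
    using A by (auto simp: eigenvalue_def eigenvector_def)
  interpret cof_vec_space n "TYPE(complex)" .
  define b where "b = basis_completion v"
  define ws where "ws = gram_schmidt n b"
  note bc = basis_completion[OF v(1,2), folded b_def]
  note gs = gram_schmidt_result[OF bc(2) bc(4) bc(5) ws_def]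
  obtain vs where bv: "b = v # vs" using bc(6,7) n by (cases b) auto
  have len: "length ws = n" using gs(4) bc(6) by simp
  have "hd ws = v" unfolding ws_def bv using v(1) by simp
  then have ws0: "ws ! 0 = v" using len n by (cases ws) auto
  have carr: "ws ! j \<in> carrier_vec n" if "j < n" for j using gs(3) len that by auto
  define s where "s = (\<lambda>j. \<Sum>k<n. (cmod (ws ! j $ k))\<^sup>2)"
  have inner: "ws ! i \<bullet>c ws ! j = (\<Sum>k<n. ws ! i $ k * cnj (ws ! j $ k))" if "i < n" "j < n" for i j
    using carr[OF that(2)] by (simp add: scalar_prod_def lessThan_atLeast0)
  have s: "ws ! j \<bullet>c ws ! j = complex_of_real (s j)" if "j < n" for j
    using that by (simp add: inner s_def complex_norm_square del: of_real_power)
  have s_pos: "0 < s j" if "j < n" for j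
  proof -
    have "ws ! j \<bullet>c ws ! j \<noteq> 0" using corthogonalD[OF gs(2), of j j] len that by simp
    then have "s j \<noteq> 0" using s[OF that] by simp
    moreover have "0 \<le> s j" by (simp add: s_def sum_nonneg)
    ultimately show ?thesis by simp
  qed
  define W where "W = mat n n (\<lambda>(i, j). ws ! j $ i / complex_of_real (sqrt (s j)))"
  have W: "W \<in> carrier_mat n n" by (simp add: W_def)
  have "mat_adjoint W * W = 1\<^sub>m n"
  proof (rule eq_matI)
    fix i j assume "i < dim_row (1\<^sub>m n :: complex mat)" "j < dim_col (1\<^sub>m n :: complex mat)"
    then have ij: "i < n" "j < n" by auto
    have "(mat_adjoint W * W) $$ (i, j) = (\<Sum>k<n. cnj (W $$ (k, i)) * W $$ (k, j))"
      using W ij by (simp add: scalar_prod_def lessThan_atLeast0)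
    also have "\<dots> = (\<Sum>k<n. ws ! j $ k * cnj (ws ! i $ k)) / complex_of_real (sqrt (s i) * sqrt (s j))"
      using ij by (simp add: W_def sum_divide_distrib mult.commute)
    also have "\<dots> = (ws ! j \<bullet>c ws ! i) / complex_of_real (sqrt (s i) * sqrt (s j))"
      using ij by (simp add: inner)
    also have "\<dots> = (if i = j then 1 else 0)"
    proof (cases "i = j")
      case True
      have "complex_of_real (sqrt (s j)) * complex_of_real (sqrt (s j)) = complex_of_real (s j)"
        using s_pos[OF ij(2)] by (simp flip: of_real_mult)
      then show ?thesis using True s[OF ij(2)] s_pos[OF ij(2)] by simp
    next
      case False
      then show ?thesis using corthogonalD[OF gs(2), of j i] len ij by simp
    qed
    finally show "(mat_adjoint W * W) $$ (i, j) = 1\<^sub>m n $$ (i, j)" using ij by simp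
  qed (use W in auto)
  moreover have "(A * W) $$ (i, 0) = e * W $$ (i, 0)" if i: "i < n" for i
  proof -
    have "(A * W) $$ (i, 0) = (\<Sum>k<n. A $$ (i, k) * v $ k) / complex_of_real (sqrt (s 0))"
      unfolding mat_mult_index[OF A W i n] using n by (simp add: W_def ws0 sum_divide_distrib)
    also have "(\<Sum>k<n. A $$ (i, k) * v $ k) = (A *\<^sub>v v) $ i"
      using A v(1) i by (simp add: scalar_prod_def lessThan_atLeast0)
    also have "\<dots> = e * v $ i" unfolding v(3) using v(1) i by simp
    finally show ?thesis using i n by (simp add: W_def ws0)
  qed
  ultimately show ?thesis using W that by blast
qed

text \<open>Deflation: in an orthonormal basis that starts with an eigenvector, the first column of
  \<open>A\<close> vanishes below the diagonal. Being Hermitian, \<open>A\<close> then also has a vanishing first row to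
  the right of the diagonal and a real corner entry, so \<open>A\<close> splits into that real number and a
  Hermitian block \<open>C\<close> of size one less, to which the induction hypothesis applies.\<close>

theorem hermitian_spectral_form:
  assumes "A \<in> carrier_mat n n" "mat_adjoint A = A"
  shows "\<exists>U d. spectral_form n A U d"
  using assms
proof (induction n arbitrary: A)
  case 0
  have "spectral_form 0 A (1\<^sub>m 0) (\<lambda>_. 0)"
    by (rule spectral_formI) (use 0 in \<open>auto simp: mat_diag_def intro!: eq_matI\<close>)
  then show ?case by blast
next
  case (Suc m)
  note A = Suc.prems(1) and herm = Suc.prems(2)
  obtain W e where W: "W \<in> carrier_mat (Suc m) (Suc m)" "mat_adjoint W * W = 1\<^sub>m (Suc m)"
    and We: "\<And>i. i < Suc m \<Longrightarrow> (A * W) $$ (i, 0) = e * W $$ (i, 0)"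
    using unitary_first_eigenvector[OF A] by blast
  have W': "mat_adjoint W \<in> carrier_mat (Suc m) (Suc m)" using W(1) by (rule mat_adjoint_carrier)
  have WW': "W * mat_adjoint W = 1\<^sub>m (Suc m)"
    using mat_mult_left_right_inverse[OF W' W(1) W(2)] .
  have AW: "A * W \<in> carrier_mat (Suc m) (Suc m)" using A W by simp
  define B where "B = mat_adjoint W * (A * W)"
  have B: "B \<in> carrier_mat (Suc m) (Suc m)" using W' AW by (simp add: B_def)
  have "mat_adjoint B = mat_adjoint W * A * W"
    unfolding B_def mat_adjoint_mult[OF W' AW] mat_adjoint_mult[OF A W(1)] by (simp add: herm)
  then have B_herm: "mat_adjoint B = B"
    using W' A W by (simp add: B_def assoc_mult_mat[of _ "Suc m" "Suc m" _ "Suc m" _ "Suc m"])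
  have B_sym: "cnj (B $$ (j, i)) = B $$ (i, j)" if "i < Suc m" "j < Suc m" for i j
    using that B mat_adjoint_index[of i B j] by (simp add: B_herm)
  have B_col: "B $$ (i, 0) = (if i = 0 then e else 0)" if i: "i < Suc m" for i
  proof -
    have "B $$ (i, 0) = (\<Sum>k<Suc m. mat_adjoint W $$ (i, k) * (e * W $$ (k, 0)))"
      using i by (simp add: B_def mat_mult_index[OF W' AW] We)
    also have "\<dots> = e * (mat_adjoint W * W) $$ (i, 0)"
      using i by (simp add: mat_mult_index[OF W' W(1)] sum_distrib_left algebra_simps)
    finally show ?thesis using i by (simp add: W(2))
  qed
  have B_row: "B $$ (0, j) = (if j = 0 then e else 0)" if j: "j < Suc m" for j
    using B_sym[of 0 j] B_col[of j] B_sym[of 0 0] B_col[of 0] j by auto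
  have e: "complex_of_real (Re e) = e"
    using B_sym[of 0 0] B_col[of 0] by (simp add: complex_eq_iff)
  define C where "C = mat m m (\<lambda>(i, j). B $$ (Suc i, Suc j))"
  have "mat_adjoint C = C"
    by (rule eq_matI) (auto simp: C_def B_sym)
  moreover have C: "C \<in> carrier_mat m m" by (simp add: C_def)
  ultimately obtain V d where V: "spectral_form m C V d" using Suc.IH by blast
  let ?D = "\<lambda>n d. mat_diag n (\<lambda>i. complex_of_real (d i))"
  have Vc: "V \<in> carrier_mat m m" and VV: "mat_adjoint V * V = 1\<^sub>m m"
    using V by (auto simp: spectral_form_def unitary_mat_def)
  note Vc' = mat_adjoint_carrier[OF Vc]
  have CV: "C * V = V * ?D m d"
  proof -
    have "C * V = V * ?D m d * (mat_adjoint V * V)"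
      using V Vc Vc' by (simp add: spectral_form_def assoc_mult_mat[of _ m m _ m _ m] mult_carrier_mat[of _ m m _ m] del: VV)
    also have "\<dots> = V * ?D m d"
      using Vc by (simp add: VV right_mult_one_mat[of _ m m] mult_carrier_mat[of _ m m _ m])
    finally show ?thesis .
  qed
  \<comment> \<open>\<open>X\<close> is the block matrix \<open>diag(1, V)\<close>, and \<open>\<delta>\<close> lists the corner entry followed by the eigenvalues of \<open>C\<close>.\<close>
  define X where "X = mat (Suc m) (Suc m) (\<lambda>(i, j). case (i, j) of
     (0, 0) \<Rightarrow> 1 | (0, Suc _) \<Rightarrow> 0 | (Suc _, 0) \<Rightarrow> 0 | (Suc i, Suc j) \<Rightarrow> V $$ (i, j))"
  define \<delta> where "\<delta> = case_nat (Re e) d"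
  have X: "X \<in> carrier_mat (Suc m) (Suc m)" by (simp add: X_def)
  note X' = mat_adjoint_carrier[OF X]
  have VV_index: "(\<Sum>k<m. cnj (V $$ (k, i)) * V $$ (k, j)) = (if i = j then 1 else 0)" if "i < m" "j < m" for i j
  proof -
    have "(mat_adjoint V * V) $$ (i, j) = (\<Sum>k<m. cnj (V $$ (k, i)) * V $$ (k, j))"
      using that Vc by (simp add: mat_mult_index[OF Vc' Vc] del: index_mult_mat(1))
    then show ?thesis using that by (simp add: VV)
  qed
  have CV_index: "(\<Sum>k<m. B $$ (Suc i, Suc k) * V $$ (k, j)) = V $$ (i, j) * complex_of_real (d j)" if "i < m" "j < m" for i j
  proof -
    have "(C * V) $$ (i, j) = (\<Sum>k<m. B $$ (Suc i, Suc k) * V $$ (k, j))"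
      unfolding mat_mult_index[OF C Vc that] using that by (simp add: C_def)
    then show ?thesis using that by (simp add: CV mat_diag_mult_right[OF Vc])
  qed
  have XX: "mat_adjoint X * X = 1\<^sub>m (Suc m)"
  proof (rule eq_matI)
    fix i j assume "i < dim_row (1\<^sub>m (Suc m) :: complex mat)" "j < dim_col (1\<^sub>m (Suc m) :: complex mat)"
    then have ij: "i < Suc m" "j < Suc m" by auto
    have "(mat_adjoint X * X) $$ (i, j) = (\<Sum>k<Suc m. cnj (X $$ (k, i)) * X $$ (k, j))"
      unfolding mat_mult_index[OF X' X ij] using ij X by (intro sum.cong refl) auto
    also have "\<dots> = (if i = j then 1 else 0)"
      unfolding sum.lessThan_Suc_shift using ij
      by (cases i; cases j) (simp_all add: X_def VV_index)
    finally show "(mat_adjoint X * X) $$ (i, j) = 1\<^sub>m (Suc m) $$ (i, j)" using ij by simp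
  qed (use X in auto)
  have BX: "B * X = X * ?D (Suc m) \<delta>"
  proof (rule eq_matI)
    fix i j assume "i < dim_row (X * ?D (Suc m) \<delta>)" "j < dim_col (X * ?D (Suc m) \<delta>)"
    then have ij: "i < Suc m" "j < Suc m" using X by (auto simp: mat_diag_def)
    have "(B * X) $$ (i, j) = (\<Sum>k<Suc m. B $$ (i, k) * X $$ (k, j))"
      by (rule mat_mult_index[OF B X ij])
    also have "\<dots> = X $$ (i, j) * complex_of_real (\<delta> j)"
      unfolding sum.lessThan_Suc_shift using ij
      by (cases i; cases j) (simp_all add: X_def B_col B_row CV_index \<delta>_def e)
    finally show "(B * X) $$ (i, j) = (X * ?D (Suc m) \<delta>) $$ (i, j)"
      using ij by (simp add: mat_diag_mult_right[OF X])
  qed (use B X in \<open>auto simp: mat_diag_def\<close>)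
  note ac = assoc_mult_mat[of _ "Suc m" "Suc m" _ "Suc m" _ "Suc m"] mult_carrier_mat[of _ "Suc m" "Suc m" _ "Suc m"]
  have "spectral_form (Suc m) A (W * X) \<delta>"
  proof (rule spectral_formI)
    have "mat_adjoint (W * X) * (W * X) = mat_adjoint X * ((mat_adjoint W * W) * X)"
      using W(1) W' X X' by (simp add: mat_adjoint_mult[OF W(1) X] ac)
    also have "\<dots> = 1\<^sub>m (Suc m)" using X by (simp add: W(2) XX)
    finally show "mat_adjoint (W * X) * (W * X) = 1\<^sub>m (Suc m)" .
    have "A * (W * X) = (W * mat_adjoint W) * (A * (W * X))"
      using A W(1) X by (simp add: WW' mult_carrier_mat[of _ "Suc m" "Suc m" _ "Suc m"])
    also have "\<dots> = W * (B * X)" unfolding B_def using A W(1) W' X by (simp add: ac)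
    also have "\<dots> = W * X * ?D (Suc m) \<delta>" unfolding BX using W(1) X by (simp add: ac)
    finally show "A * (W * X) = W * X * ?D (Suc m) \<delta>" .
  qed (use A W X in auto)
  then show ?case by blast
qed

section \<open>Functional calculus and the entropy of a Gibbs state\<close>

lemma spectral_form_carrier: "spectral_form n A U d \<Longrightarrow> A \<in> carrier_mat n n"
  by (auto simp: spectral_form_def mat_adjoint_carrier)

lemma spectral_form_vectors:
  assumes "spectral_form n A U d"
  shows "U \<in> carrier_mat n n" "mat_adjoint U \<in> carrier_mat n n"
    "mat_adjoint U * U = 1\<^sub>m n" "U * mat_adjoint U = 1\<^sub>m n"
  using assms by (auto simp: spectral_form_def unitary_mat_def mat_adjoint_carrier)

lemma orthonormal_columns:
  assumes "spectral_form n A U d" "i < n" "j < n"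
  shows "(\<Sum>k<n. cnj (U $$ (k, i)) * U $$ (k, j)) = (if i = j then 1 else 0)"
proof -
  note U = spectral_form_vectors[OF assms(1)]
  have "(mat_adjoint U * U) $$ (i, j) = (\<Sum>k<n. cnj (U $$ (k, i)) * U $$ (k, j))"
    using U(1) assms by (simp add: mat_mult_index[OF U(2,1)] del: index_mult_mat(1))
  then show ?thesis using assms U by simp
qed

lemma orthonormal_rows:
  assumes "spectral_form n A U d" "i < n" "j < n"
  shows "(\<Sum>k<n. U $$ (i, k) * cnj (U $$ (j, k))) = (if i = j then 1 else 0)"
proof -
  note U = spectral_form_vectors[OF assms(1)]
  have "(U * mat_adjoint U) $$ (i, j) = (\<Sum>k<n. U $$ (i, k) * cnj (U $$ (j, k)))"
    using U(1) assms by (simp add: mat_mult_index[OF U(1,2)] del: index_mult_mat(1))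
  then show ?thesis using assms U by simp
qed

lemma diagonal_conjugate_index:
  assumes U: "U \<in> carrier_mat n n" and ij: "i < n" "j < n"
  shows "(U * mat_diag n D * mat_adjoint U) $$ (i, j) = (\<Sum>k<n. U $$ (i, k) * D k * cnj (U $$ (j, k)))"
proof -
  have "U * mat_diag n D \<in> carrier_mat n n" using U by (simp add: mult_carrier_mat[of _ n n _ n])
  then have "(U * mat_diag n D * mat_adjoint U) $$ (i, j) =
      (\<Sum>k<n. (U * mat_diag n D) $$ (i, k) * mat_adjoint U $$ (k, j))"
    using mat_adjoint_carrier[OF U] ij by (rule mat_mult_index)
  then show ?thesis using U ij by (simp add: mat_diag_mult_right[OF U])
qed

lemma spectral_form_index:
  assumes "spectral_form n A U d" "i < n" "j < n"
  shows "A $$ (i, j) = (\<Sum>k<n. U $$ (i, k) * complex_of_real (d k) * cnj (U $$ (j, k)))"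
proof -
  have U: "U \<in> carrier_mat n n" and A: "A = U * mat_diag n (\<lambda>i. complex_of_real (d i)) * mat_adjoint U"
    using assms(1) by (auto simp: spectral_form_def)
  show ?thesis unfolding A by (rule diagonal_conjugate_index[OF U assms(2,3)])
qed

text \<open>The rules of the functional calculus below all keep the basis \<open>U\<close>, so they come down to
  computing matrix entries; the form of \<open>A\<close> provides the unitarity of \<open>U\<close>.\<close>

lemma spectral_form_indexI:
  assumes A: "spectral_form n A U d" and B: "B \<in> carrier_mat n n"
    and index: "\<And>i j. i < n \<Longrightarrow> j < n \<Longrightarrow>
      B $$ (i, j) = (\<Sum>k<n. U $$ (i, k) * complex_of_real (e k) * cnj (U $$ (j, k)))"
  shows "spectral_form n B U e"
proof -
  have U: "U \<in> carrier_mat n n" "unitary_mat U" using A by (auto simp: spectral_form_def)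
  have "B = U * mat_diag n (\<lambda>i. complex_of_real (e i)) * mat_adjoint U"
    by (rule eq_matI) (use U(1) B in \<open>auto simp: diagonal_conjugate_index index simp del: index_mult_mat(1)\<close>)
  then show ?thesis using U by (simp add: spectral_form_def)
qed

lemma spectral_form_eigenvector:
  assumes A: "spectral_form n A U d" and ik: "i < n" "k < n"
  shows "(\<Sum>j<n. A $$ (i, j) * U $$ (j, k)) = complex_of_real (d k) * U $$ (i, k)"
proof -
  have "(\<Sum>j<n. A $$ (i, j) * U $$ (j, k)) =
      (\<Sum>j<n. \<Sum>l<n. U $$ (i, l) * complex_of_real (d l) * (cnj (U $$ (j, l)) * U $$ (j, k)))"
    using ik by (simp add: spectral_form_index[OF A] sum_distrib_right mult.assoc)
  also have "\<dots> = (\<Sum>l<n. U $$ (i, l) * complex_of_real (d l) * (\<Sum>j<n. cnj (U $$ (j, l)) * U $$ (j, k)))"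
    by (subst sum.swap) (simp add: sum_distrib_left)
  also have "\<dots> = (\<Sum>l<n. if l = k then U $$ (i, l) * complex_of_real (d l) else 0)"
    using ik by (intro sum.cong refl) (simp add: orthonormal_columns[OF A])
  finally show ?thesis using ik by (simp add: mult.commute)
qed

lemma spectral_form_mult:
  assumes A: "spectral_form n A U d" and B: "spectral_form n B U e"
  shows "spectral_form n (A * B) U (\<lambda>i. d i * e i)"
proof (rule spectral_form_indexI[OF A])
  note Ac = spectral_form_carrier[OF A] and Bc = spectral_form_carrier[OF B]
  show "A * B \<in> carrier_mat n n" using Ac Bc by simp
  fix i j assume ij: "i < n" "j < n"
  have "(A * B) $$ (i, j) = (\<Sum>l<n. \<Sum>k<n. A $$ (i, l) * U $$ (l, k) * (complex_of_real (e k) * cnj (U $$ (j, k))))"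
    using ij by (simp add: mat_mult_index[OF Ac Bc] spectral_form_index[OF B] sum_distrib_left mult.assoc)
  also have "\<dots> = (\<Sum>k<n. (\<Sum>l<n. A $$ (i, l) * U $$ (l, k)) * (complex_of_real (e k) * cnj (U $$ (j, k))))"
    by (subst sum.swap) (simp add: sum_distrib_right)
  finally show "(A * B) $$ (i, j) = (\<Sum>k<n. U $$ (i, k) * complex_of_real (d k * e k) * cnj (U $$ (j, k)))"
    using ij by (simp add: spectral_form_eigenvector[OF A] mult_ac)
qed

lemma spectral_form_smult:
  assumes A: "spectral_form n A U d"
  shows "spectral_form n (complex_of_real c \<cdot>\<^sub>m A) U (\<lambda>i. c * d i)"
  using spectral_form_carrier[OF A]
  by (intro spectral_form_indexI[OF A])
     (auto simp: spectral_form_index[OF A] sum_distrib_left mult_ac)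

lemma spectral_form_power:
  assumes A: "spectral_form n A U d"
  shows "spectral_form n (A ^\<^sub>m k) U (\<lambda>i. d i ^ k)"
proof (induction k)
  case 0
  show ?case
    by (rule spectral_form_indexI[OF A])
       (use spectral_form_carrier[OF A] in \<open>auto simp: orthonormal_rows[OF A]\<close>)
next
  case (Suc k)
  from spectral_form_mult[OF Suc A] show ?case by (simp add: mult.commute)
qed

text \<open>Entrywise, the exponential series is a finite linear combination, with coefficients from \<open>U\<close>,
  of the scalar exponential series of the eigenvalues, so it may be summed term by term.\<close>

lemma spectral_form_exp:
  assumes A: "spectral_form n A U d"
  shows "spectral_form n (mat_exp A) U (\<lambda>i. exp (d i))"
proof (rule spectral_form_indexI[OF A])
  note Ac = spectral_form_carrier[OF A]
  show "mat_exp A \<in> carrier_mat n n" using Ac by (simp add: mat_exp_def)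
  fix i j assume ij: "i < n" "j < n"
  have "(\<lambda>k. \<Sum>l<n. U $$ (i, l) * (complex_of_real (d l) ^ k /\<^sub>R fact k) * cnj (U $$ (j, l)))
        sums (\<Sum>l<n. U $$ (i, l) * exp (complex_of_real (d l)) * cnj (U $$ (j, l)))"
    by (intro sums_sum sums_mult sums_mult2 exp_converges)
  also have "(\<lambda>k. \<Sum>l<n. U $$ (i, l) * (complex_of_real (d l) ^ k /\<^sub>R fact k) * cnj (U $$ (j, l))) =
        (\<lambda>k. (A ^\<^sub>m k) $$ (i, j) / fact k)"
    using ij by (intro ext)
      (simp add: spectral_form_index[OF spectral_form_power[OF A]] sum_distrib_left sum_distrib_right scaleR_conv_of_real divide_inverse mult_ac)
  finally show "mat_exp A $$ (i, j) = (\<Sum>k<n. U $$ (i, k) * complex_of_real (exp (d k)) * cnj (U $$ (j, k)))"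
    using ij Ac by (simp add: mat_exp_def sums_unique[symmetric] exp_of_real)
qed

lemma spectral_form_trace:
  assumes A: "spectral_form n A U d"
  shows "mat_trace A = complex_of_real (\<Sum>i<n. d i)"
proof -
  have "mat_trace A = (\<Sum>i<n. \<Sum>k<n. complex_of_real (d k) * (cnj (U $$ (i, k)) * U $$ (i, k)))"
    using spectral_form_carrier[OF A]
    by (auto simp: mat_trace_def spectral_form_index[OF A] mult_ac intro!: sum.cong)
  also have "\<dots> = (\<Sum>k<n. complex_of_real (d k) * (\<Sum>i<n. cnj (U $$ (i, k)) * U $$ (i, k)))"
    by (subst sum.swap) (simp add: sum_distrib_left)
  finally show ?thesis by (simp add: orthonormal_columns[OF A])
qed

lemma spectral_form_gibbs:
  assumes H: "spectral_form n H U d"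
  shows "spectral_form n (gibbs_state \<tau> H) U (\<lambda>i. exp (- \<tau> * d i) / (\<Sum>k<n. exp (- \<tau> * d k)))"
proof -
  let ?Z = "\<Sum>k<n. exp (- \<tau> * d k)"
  note X = spectral_form_exp[OF spectral_form_smult[OF H, of "- \<tau>"]]
  have "gibbs_state \<tau> H = complex_of_real (1 / ?Z) \<cdot>\<^sub>m mat_exp (complex_of_real (- \<tau>) \<cdot>\<^sub>m H)"
    using spectral_form_trace[OF X] by (simp add: gibbs_state_def Let_def)
  then show ?thesis using spectral_form_smult[OF X, of "1 / ?Z"] by simp
qed

lemma entropy_spectral_form:
  assumes \<rho>: "spectral_form n \<rho> U q"
  shows "von_neumann_entropy \<rho> = - (\<Sum>i<n. q i * ln (q i))"
proof -
  define B where "B = U * mat_diag n (\<lambda>i. complex_of_real ((ln \<circ> q) i)) * mat_adjoint U"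
  have B: "spectral_form n B U (ln \<circ> q)"
    using \<rho> by (simp add: spectral_form_def B_def)
  have "hermitian_fun ln \<rho> = B" by (rule hermitian_fun_eq[OF \<rho> B])
  then show ?thesis
    using spectral_form_trace[OF spectral_form_mult[OF \<rho> B]] by (simp add: von_neumann_entropy_def)
qed

text \<open>Half of the exponential decay absorbs the linear factor. This turns the energy term of the
  entropy into a sum of the same kind as the partition function.\<close>

lemma mult_exp_minus_le: "x * exp (- x) \<le> exp (- x / 2)" if "0 \<le> x" for x :: real
proof -
  have "x \<le> (1 + x / 4)\<^sup>2"
    using zero_le_power2[of "1 - x / 4"] by (simp add: power2_eq_square algebra_simps)
  also have "\<dots> \<le> (exp (x / 4))\<^sup>2"
    using that by (intro power_mono exp_ge_add_one_self) auto
  also have "\<dots> = exp (x / 2)" by (simp add: power2_eq_square flip: exp_add)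
  finally have "x * exp (- x) \<le> exp (x / 2) * exp (- x)" by (intro mult_right_mono) auto
  also have "\<dots> = exp (- x / 2)" by (simp flip: exp_add)
  finally show ?thesis .
qed

text \<open>With \<open>Z\<close> the partition function, the entropy is \<open>ln Z\<close> plus the mean of \<open>\<tau> d\<^sub>k\<close>. The ground
  state contributes \<open>1\<close> to \<open>Z\<close> and nothing to the mean. As \<open>ln Z \<le> Z - 1\<close>, both terms are
  bounded by sums over the excited states, and each of these contributes at most
  \<open>exp (- \<tau> g / 2)\<close> to either sum.\<close>

lemma gibbs_entropy_le:
  assumes H: "spectral_form n H U d" and \<tau>: "0 < \<tau>"
    and k0: "k0 < n" "d k0 = 0"
    and gap: "\<And>k. k < n \<Longrightarrow> k \<noteq> k0 \<Longrightarrow> g \<le> d k" and g: "0 \<le> g"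
  shows "von_neumann_entropy (gibbs_state \<tau> H) \<le> 2 * n * exp (- \<tau> * g / 2)"
proof -
  define x where "x = (\<lambda>k. \<tau> * d k)"
  define Z where "Z = (\<Sum>k<n. exp (- x k))"
  define I where "I = {..<n} - {k0}"
  define b where "b = exp (- \<tau> * g / 2)"
  have I: "{..<n} = insert k0 I" "k0 \<notin> I" "finite I" using k0 by (auto simp: I_def)
  have x0: "x k0 = 0" using k0 by (simp add: x_def)
  have xI: "\<tau> * g \<le> x k" if "k \<in> I" for k
    using gap[of k] that \<tau> by (auto simp: I_def x_def)
  have \<tau>g: "0 \<le> \<tau> * g" using \<tau> g by simp
  have half: "exp (- x k / 2) \<le> b" if "k \<in> I" for k using xI[OF that] by (simp add: b_def)
  have Z: "Z = 1 + (\<Sum>k\<in>I. exp (- x k))" using I by (simp add: Z_def x0)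
  have Z1: "1 \<le> Z" unfolding Z by (simp add: sum_nonneg)
  have card: "(\<Sum>k\<in>I. b) \<le> n * b"
  proof -
    have "card I \<le> n" using I k0 by (simp add: I_def)
    then show ?thesis by (simp add: b_def)
  qed
  have "von_neumann_entropy (gibbs_state \<tau> H) = - (\<Sum>k<n. exp (- x k) / Z * ln (exp (- x k) / Z))"
    using entropy_spectral_form[OF spectral_form_gibbs[OF H, of \<tau>]] by (simp add: x_def Z_def)
  also have "\<dots> = (\<Sum>k<n. exp (- x k) / Z * ln Z + x k * exp (- x k) / Z)"
    unfolding sum_negf[symmetric] using Z1
    by (intro sum.cong refl) (simp add: ln_div field_simps)
  also have "\<dots> = ln Z + (\<Sum>k<n. x k * exp (- x k)) / Z"
    using Z1 by (simp add: sum.distrib sum_divide_distrib[symmetric] sum_distrib_right[symmetric] Z_def[symmetric])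
  also have "(\<Sum>k<n. x k * exp (- x k)) = (\<Sum>k\<in>I. x k * exp (- x k))"
    using I by (simp add: x0)
  also have "(\<Sum>k\<in>I. x k * exp (- x k)) / Z \<le> (\<Sum>k\<in>I. b) / Z"
    using Z1 by (intro divide_right_mono sum_mono order_trans[OF mult_exp_minus_le half])
      (use xI \<tau>g order_trans in auto)
  also have "(\<Sum>k\<in>I. b) / Z \<le> (\<Sum>k\<in>I. b)"
    using mult_left_mono[OF Z1, of "\<Sum>k\<in>I. b"] Z1 by (simp add: divide_le_eq b_def)
  also have "ln Z \<le> (\<Sum>k\<in>I. exp (- x k))"
    using ln_le_minus_one[of Z] Z1 by (simp add: Z)
  also have "\<dots> \<le> (\<Sum>k\<in>I. b)"
  proof (intro sum_mono)
    fix k assume k: "k \<in> I"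
    have "exp (- x k) \<le> exp (- x k / 2)" using xI[OF k] \<tau>g by simp
    also have "\<dots> \<le> b" by (rule half[OF k])
    finally show "exp (- x k) \<le> b" .
  qed
  finally have "von_neumann_entropy (gibbs_state \<tau> H) \<le> (\<Sum>k\<in>I. b) + (\<Sum>k\<in>I. b)" by simp
  with card show ?thesis unfolding b_def[symmetric] by linarith
qed

section \<open>Cheeger's inequality\<close>

text \<open>The discrete coarea formula: \<open>\<psi>\<close> is a nonnegative combination of indicator functions of its
  superlevel sets, along which \<open>\<bar>\<psi> i - \<psi> j\<bar>\<close> is additive, so the claim reduces to the cut condition
  for these sets. The induction peels off the lowest level, that is, the support \<open>T\<close> of \<open>\<psi>\<close>
  weighted by the least positive value \<open>m\<close>. The factor 2 appears because each pair is summed in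
  both orders.\<close>

lemma coarea_inequality:
  fixes a :: "'a \<Rightarrow> 'a \<Rightarrow> real" and h :: real
  assumes V: "finite V"
    and sym: "\<And>i j. a i j = a j i"
    and cut: "\<And>S. S \<subseteq> V \<Longrightarrow> 2 * card S \<le> card V \<Longrightarrow>
               h * real (card S) \<le> (\<Sum>i\<in>S. \<Sum>j\<in>V - S. a i j)"
    and nonneg: "\<And>i. i \<in> V \<Longrightarrow> 0 \<le> \<psi> i"
    and small: "2 * card {i \<in> V. 0 < \<psi> i} \<le> card V"
  shows "2 * h * (\<Sum>i\<in>V. \<psi> i) \<le> (\<Sum>i\<in>V. \<Sum>j\<in>V. a i j * \<bar>\<psi> i - \<psi> j\<bar>)"
  using nonneg small
proof (induction "card {i \<in> V. 0 < \<psi> i}" arbitrary: \<psi> rule: less_induct)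
  case less
  define T where "T = {i \<in> V. 0 < \<psi> i}"
  have T: "T \<subseteq> V" "finite T" using V by (auto simp: T_def)
  show ?case
  proof (cases "T = {}")
    case True
    then have "\<And>i. i \<in> V \<Longrightarrow> \<psi> i = 0"
      using less.prems(1) by (fastforce simp: T_def)
    then show ?thesis by simp
  next
    case False
    define m where "m = Min (\<psi> ` T)"
    have m: "m \<in> \<psi> ` T" "\<And>i. i \<in> T \<Longrightarrow> m \<le> \<psi> i"
      using T False by (auto simp: m_def)
    have m0: "0 < m" using m(1) by (auto simp: T_def)
    define ind where "ind = (\<lambda>i. if i \<in> T then 1 else 0 :: real)"
    define \<psi>' where "\<psi>' = (\<lambda>i. \<psi> i - m * ind i)"
    have outside: "\<psi> i = 0" if "i \<in> V" "i \<notin> T" for i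
      using that less.prems(1)[of i] by (auto simp: T_def)
    have nonneg': "0 \<le> \<psi>' i" if "i \<in> V" for i
      using that m(2) outside by (auto simp: \<psi>'_def ind_def)
    have sub: "{i \<in> V. 0 < \<psi>' i} \<subset> T"
    proof -
      obtain k where "k \<in> T" "\<psi> k = m" using m(1) by auto
      then have "k \<in> T" "k \<notin> {i \<in> V. 0 < \<psi>' i}" by (auto simp: \<psi>'_def ind_def)
      moreover have "{i \<in> V. 0 < \<psi>' i} \<subseteq> T"
        by (rule subsetI, rule ccontr) (use outside in \<open>auto simp: \<psi>'_def ind_def\<close>)
      ultimately show ?thesis by blast
    qed
    have lt: "card {i \<in> V. 0 < \<psi>' i} < card T"
      using sub T by (intro psubset_card_mono) auto
    have IH: "2 * h * (\<Sum>i\<in>V. \<psi>' i) \<le> (\<Sum>i\<in>V. \<Sum>j\<in>V. a i j * \<bar>\<psi>' i - \<psi>' j\<bar>)"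
      using less.hyps[OF lt[unfolded T_def]] nonneg' lt less.prems(2) by (simp add: T_def)
    \<comment> \<open>If exactly one of \<open>i\<close>, \<open>j\<close> lies in \<open>T\<close>, both differences have the same sign; otherwise the indicators agree.\<close>
    have split: "\<bar>\<psi> i - \<psi> j\<bar> = \<bar>\<psi>' i - \<psi>' j\<bar> + m * \<bar>ind i - ind j\<bar>" if "i \<in> V" "j \<in> V" for i j
      using that nonneg'[of i] nonneg'[of j] outside[of i] outside[of j] m0
      by (auto simp: \<psi>'_def ind_def)
    have boundary: "2 * h * real (card T) \<le> (\<Sum>i\<in>V. \<Sum>j\<in>V. a i j * \<bar>ind i - ind j\<bar>)"
    proof -
      have V_split: "V = T \<union> (V - T)" using T by blast
      have "(\<Sum>i\<in>V. \<Sum>j\<in>V. a i j * \<bar>ind i - ind j\<bar>) =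
            (\<Sum>i\<in>T. \<Sum>j\<in>V. a i j * \<bar>ind i - ind j\<bar>) + (\<Sum>i\<in>V - T. \<Sum>j\<in>V. a i j * \<bar>ind i - ind j\<bar>)"
        using T V by (subst sum.subset_diff[of T V]) auto
      also have "(\<Sum>i\<in>T. \<Sum>j\<in>V. a i j * \<bar>ind i - ind j\<bar>) = (\<Sum>i\<in>T. \<Sum>j\<in>V - T. a i j)"
        using T V by (intro sum.cong refl sum.mono_neutral_cong_right) (auto simp: ind_def)
      also have "(\<Sum>i\<in>V - T. \<Sum>j\<in>V. a i j * \<bar>ind i - ind j\<bar>) = (\<Sum>i\<in>V - T. \<Sum>j\<in>T. a j i)"
        using T V sym by (intro sum.cong refl sum.mono_neutral_cong_right) (auto simp: ind_def)
      also have "\<dots> = (\<Sum>i\<in>T. \<Sum>j\<in>V - T. a i j)" by (rule sum.swap)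
      finally show ?thesis
        using cut[OF T(1)] less.prems(2) by (simp add: T_def)
    qed
    have "(\<Sum>i\<in>V. \<psi> i) = (\<Sum>i\<in>V. \<psi>' i) + m * real (card T)"
    proof -
      have "(\<Sum>i\<in>V. ind i) = (\<Sum>i\<in>T. 1)"
        using T V by (intro sum.mono_neutral_cong_right) (auto simp: ind_def)
      then show ?thesis by (simp add: \<psi>'_def sum_subtractf flip: sum_distrib_left)
    qed
    then have "2 * h * (\<Sum>i\<in>V. \<psi> i) = 2 * h * (\<Sum>i\<in>V. \<psi>' i) + m * (2 * h * real (card T))"
      by (simp add: algebra_simps)
    also have "\<dots> \<le> (\<Sum>i\<in>V. \<Sum>j\<in>V. a i j * \<bar>\<psi>' i - \<psi>' j\<bar>) + m * (\<Sum>i\<in>V. \<Sum>j\<in>V. a i j * \<bar>ind i - ind j\<bar>)"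
      using IH boundary m0 by (intro add_mono mult_left_mono) auto
    also have "\<dots> = (\<Sum>i\<in>V. \<Sum>j\<in>V. a i j * (\<bar>\<psi>' i - \<psi>' j\<bar> + m * \<bar>ind i - ind j\<bar>))"
      by (simp add: sum_distrib_left sum.distrib algebra_simps)
    also have "\<dots> = (\<Sum>i\<in>V. \<Sum>j\<in>V. a i j * \<bar>\<psi> i - \<psi> j\<bar>)"
      by (intro sum.cong refl) (simp add: split)
    finally show ?thesis .
  qed
qed

text \<open>The coarea inequality is applied to \<open>\<phi>\<^sup>2\<close>. Each difference of squares is a product
  \<open>\<bar>\<phi> i - \<phi> j\<bar> \<bar>\<phi> i + \<phi> j\<bar>\<close>, which the weighted inequality between arithmetic and geometric mean
  separates into the Dirichlet form and a multiple of the sum of \<open>\<phi>\<^sup>2\<close> controlled by the degrees.\<close>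

lemma cheeger_small_support:
  fixes a :: "'a \<Rightarrow> 'a \<Rightarrow> real" and h \<Delta> :: real
  assumes V: "finite V"
    and sym: "\<And>i j. a i j = a j i" and a0: "\<And>i j. 0 \<le> a i j"
    and cut: "\<And>S. S \<subseteq> V \<Longrightarrow> 2 * card S \<le> card V \<Longrightarrow>
               h * real (card S) \<le> (\<Sum>i\<in>S. \<Sum>j\<in>V - S. a i j)"
    and deg: "\<And>i. i \<in> V \<Longrightarrow> (\<Sum>j\<in>V. a i j) \<le> \<Delta>"
    and h: "0 < h" and \<Delta>: "0 < \<Delta>"
    and nonneg: "\<And>i. i \<in> V \<Longrightarrow> 0 \<le> \<phi> i"
    and small: "2 * card {i \<in> V. 0 < \<phi> i} \<le> card V"
  shows "h\<^sup>2 / \<Delta> * (\<Sum>i\<in>V. (\<phi> i)\<^sup>2) \<le> (\<Sum>i\<in>V. \<Sum>j\<in>V. a i j * (\<phi> i - \<phi> j)\<^sup>2)"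
proof -
  define N where "N = (\<Sum>i\<in>V. (\<phi> i)\<^sup>2)"
  define Q where "Q = (\<Sum>i\<in>V. \<Sum>j\<in>V. a i j * (\<phi> i - \<phi> j)\<^sup>2)"
  have pos: "{i \<in> V. 0 < (\<phi> i)\<^sup>2} = {i \<in> V. 0 < \<phi> i}"
    using nonneg by (auto simp: order.order_iff_strict)
  have "2 * h * N \<le> (\<Sum>i\<in>V. \<Sum>j\<in>V. a i j * \<bar>(\<phi> i)\<^sup>2 - (\<phi> j)\<^sup>2\<bar>)"
    unfolding N_def by (rule coarea_inequality) (use V sym cut small pos in auto)
  also have "\<dots> \<le> (\<Sum>i\<in>V. \<Sum>j\<in>V. \<Delta> / h * (a i j * (\<phi> i - \<phi> j)\<^sup>2) +
                    h / (2 * \<Delta>) * (a i j * (\<phi> i)\<^sup>2 + a j i * (\<phi> j)\<^sup>2))"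
  proof (intro sum_mono)
    fix i j
    \<comment> \<open>The weight \<open>t = \<Delta> / h\<close> lets the degree term consume exactly half of the left-hand side.\<close>
    define x y t where "x = \<bar>\<phi> i - \<phi> j\<bar>" and "y = \<bar>\<phi> i + \<phi> j\<bar>" and "t = \<Delta> / h"
    have t: "0 < t" using h \<Delta> by (simp add: t_def)
    have "0 \<le> (2 * t * x - y)\<^sup>2 / (4 * t)" using t by simp
    also have "\<dots> = t * x\<^sup>2 + y\<^sup>2 / (4 * t) - x * y"
      using t by (simp add: field_simps power2_eq_square)
    finally have "x * y \<le> t * x\<^sup>2 + y\<^sup>2 / (4 * t)" by simp
    also have "\<dots> \<le> t * x\<^sup>2 + (2 * (\<phi> i)\<^sup>2 + 2 * (\<phi> j)\<^sup>2) / (4 * t)"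
    proof -
      have "y\<^sup>2 \<le> 2 * (\<phi> i)\<^sup>2 + 2 * (\<phi> j)\<^sup>2"
        using zero_le_power2[of "\<phi> i - \<phi> j"] by (simp add: y_def power2_eq_square algebra_simps)
      then show ?thesis using t by (intro add_left_mono divide_right_mono) auto
    qed
    also have "\<dots> = t * (\<phi> i - \<phi> j)\<^sup>2 + 1 / (2 * t) * ((\<phi> i)\<^sup>2 + (\<phi> j)\<^sup>2)"
      using t by (simp add: x_def field_simps)
    finally have "x * y \<le> t * (\<phi> i - \<phi> j)\<^sup>2 + 1 / (2 * t) * ((\<phi> i)\<^sup>2 + (\<phi> j)\<^sup>2)" .
    moreover have "x * y = \<bar>(\<phi> i)\<^sup>2 - (\<phi> j)\<^sup>2\<bar>"
      by (simp add: x_def y_def power2_eq_square algebra_simps flip: abs_mult)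
    ultimately have "a i j * \<bar>(\<phi> i)\<^sup>2 - (\<phi> j)\<^sup>2\<bar> \<le>
        a i j * (t * (\<phi> i - \<phi> j)\<^sup>2 + 1 / (2 * t) * ((\<phi> i)\<^sup>2 + (\<phi> j)\<^sup>2))"
      using a0 by (intro mult_left_mono) auto
    also have "\<dots> = \<Delta> / h * (a i j * (\<phi> i - \<phi> j)\<^sup>2) +
                    h / (2 * \<Delta>) * (a i j * (\<phi> i)\<^sup>2 + a j i * (\<phi> j)\<^sup>2)"
      using h \<Delta> sym[of i j] by (simp add: t_def field_simps)
    finally show "a i j * \<bar>(\<phi> i)\<^sup>2 - (\<phi> j)\<^sup>2\<bar> \<le> \<dots>" .
  qed
  also have "\<dots> = \<Delta> / h * Q + h / (2 * \<Delta>) *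
      ((\<Sum>i\<in>V. \<Sum>j\<in>V. a i j * (\<phi> i)\<^sup>2) + (\<Sum>i\<in>V. \<Sum>j\<in>V. a j i * (\<phi> j)\<^sup>2))"
    unfolding Q_def sum_distrib_left by (simp add: sum.distrib distrib_left sum_distrib_left)
  also have "(\<Sum>i\<in>V. \<Sum>j\<in>V. a j i * (\<phi> j)\<^sup>2) = (\<Sum>i\<in>V. \<Sum>j\<in>V. a i j * (\<phi> i)\<^sup>2)"
    by (rule sum.swap)
  also have "\<Delta> / h * Q + h / (2 * \<Delta>) * ((\<Sum>i\<in>V. \<Sum>j\<in>V. a i j * (\<phi> i)\<^sup>2) + (\<Sum>i\<in>V. \<Sum>j\<in>V. a i j * (\<phi> i)\<^sup>2))
      \<le> \<Delta> / h * Q + h / (2 * \<Delta>) * (\<Delta> * N + \<Delta> * N)"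
  proof -
    have "(\<Sum>i\<in>V. \<Sum>j\<in>V. a i j * (\<phi> i)\<^sup>2) = (\<Sum>i\<in>V. (\<Sum>j\<in>V. a i j) * (\<phi> i)\<^sup>2)"
      by (simp add: sum_distrib_right)
    also have "\<dots> \<le> (\<Sum>i\<in>V. \<Delta> * (\<phi> i)\<^sup>2)"
      using deg by (intro sum_mono mult_right_mono) auto
    finally have "(\<Sum>i\<in>V. \<Sum>j\<in>V. a i j * (\<phi> i)\<^sup>2) \<le> \<Delta> * N"
      by (simp add: N_def sum_distrib_left)
    then show ?thesis using h \<Delta> by (intro add_left_mono mult_left_mono add_mono) (assumption | simp)+
  qed
  also have "\<dots> = \<Delta> / h * Q + h * N" using \<Delta> by simp
  finally have "h * N \<le> \<Delta> / h * Q" by (simp add: mult.commute)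
  then have "h\<^sup>2 / \<Delta> * N \<le> Q"
    using h \<Delta> by (simp add: field_simps power2_eq_square)
  then show ?thesis by (simp add: N_def Q_def)
qed

text \<open>The least value of \<open>f\<close> that is exceeded on at most half of \<open>V\<close> is a median: the next smaller
  value fails this condition, so more than half of \<open>V\<close> lies at or above \<open>m\<close>.\<close>

lemma median_exists:
  fixes f :: "'a \<Rightarrow> real"
  assumes V: "finite V"
  obtains m where "2 * card {i \<in> V. m < f i} \<le> card V" "2 * card {i \<in> V. f i < m} \<le> card V"
proof (cases "V = {}")
  case True
  then show ?thesis using that by simp
next
  case False
  define M where "M = {m \<in> f ` V. 2 * card {i \<in> V. m < f i} \<le> card V}"
  obtain x where x: "x \<in> f ` V" "\<And>i. i \<in> V \<Longrightarrow> f i \<le> x"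
    using V False Max_in[of "f ` V"] Max_ge[of "f ` V"] by blast
  then have "{i \<in> V. x < f i} = {}" by fastforce
  then have "2 * card {i \<in> V. x < f i} \<le> card V" by (metis card.empty le0 mult_0_right)
  then have "x \<in> M" using x(1) by (simp add: M_def)
  then have M: "finite M" "M \<noteq> {}" using V by (auto simp: M_def)
  define m where "m = Min M"
  have m: "m \<in> M" "\<And>x. x \<in> M \<Longrightarrow> m \<le> x" using M by (auto simp: m_def)
  define B where "B = {i \<in> V. f i < m}"
  have "2 * card B \<le> card V"
  proof (cases "B = {}")
    case False
    have B: "finite B" using V by (simp add: B_def)
    define m' where "m' = Max (f ` B)"
    have m': "m' \<in> f ` B" "\<And>i. i \<in> B \<Longrightarrow> f i \<le> m'"
      using B False by (auto simp: m'_def)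
    then have "m' < m" "m' \<in> f ` V" by (auto simp: B_def)
    then have "m' \<notin> M" using m(2) by fastforce
    then have "card V < 2 * card {i \<in> V. m' < f i}"
      using \<open>m' \<in> f ` V\<close> by (auto simp: M_def)
    also have "{i \<in> V. m' < f i} = V - B"
      using m' \<open>m' < m\<close> by (force simp: B_def)
    also have "card (V - B) = card V - card B"
      using B by (intro card_Diff_subset) (auto simp: B_def)
    finally show ?thesis by linarith
  qed simp
  with m(1) show ?thesis by (intro that[of m]) (auto simp: M_def B_def)
qed

text \<open>The subtracted square of the sum makes this a statement about \<open>f\<close> minus its mean. Shifting
  instead by a median \<open>m\<close> only increases the sum of squares, and the positive and negative parts of
  \<open>f - m\<close> then each have support of size at most half of \<open>V\<close>. Splitting into these parts does not
  increase the Dirichlet form.\<close>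

lemma cheeger_inequality:
  fixes a :: "'a \<Rightarrow> 'a \<Rightarrow> real" and h \<Delta> :: real and f :: "'a \<Rightarrow> real"
  assumes V: "finite V" "V \<noteq> {}"
    and sym: "\<And>i j. a i j = a j i" and a0: "\<And>i j. 0 \<le> a i j"
    and cut: "\<And>S. S \<subseteq> V \<Longrightarrow> 2 * card S \<le> card V \<Longrightarrow>
               h * real (card S) \<le> (\<Sum>i\<in>S. \<Sum>j\<in>V - S. a i j)"
    and deg: "\<And>i. i \<in> V \<Longrightarrow> (\<Sum>j\<in>V. a i j) \<le> \<Delta>"
    and h: "0 < h" and \<Delta>: "0 < \<Delta>"
  shows "h\<^sup>2 / \<Delta> * ((\<Sum>i\<in>V. (f i)\<^sup>2) - (\<Sum>i\<in>V. f i)\<^sup>2 / card V) \<le>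
         (\<Sum>i\<in>V. \<Sum>j\<in>V. a i j * (f i - f j)\<^sup>2)"
proof -
  obtain m where m: "2 * card {i \<in> V. m < f i} \<le> card V" "2 * card {i \<in> V. f i < m} \<le> card V"
    using median_exists[OF V(1), of f] by blast
  define g1 g2 where "g1 = (\<lambda>i. max (f i - m) 0)" and "g2 = (\<lambda>i. max (m - f i) 0)"
  have supp: "{i \<in> V. 0 < g1 i} = {i \<in> V. m < f i}" "{i \<in> V. 0 < g2 i} = {i \<in> V. f i < m}"
    by (auto simp: g1_def g2_def)
  define n where "n = real (card V)"
  define s where "s = (\<Sum>i\<in>V. f i)"
  have n: "0 < n" using V by (simp add: n_def card_gt_0_iff)
  have "(\<Sum>i\<in>V. (f i - m)\<^sup>2) = (\<Sum>i\<in>V. (f i)\<^sup>2 - 2 * m * f i + m\<^sup>2)"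
    by (intro sum.cong refl) (simp add: power2_eq_square algebra_simps)
  also have "\<dots> = (\<Sum>i\<in>V. (f i)\<^sup>2) - 2 * m * s + n * m\<^sup>2"
    by (simp add: sum.distrib sum_subtractf s_def n_def flip: sum_distrib_left)
  finally have shift: "(\<Sum>i\<in>V. (f i - m)\<^sup>2) = (\<Sum>i\<in>V. (f i)\<^sup>2) - 2 * m * s + n * m\<^sup>2" .
  have "0 \<le> (s - n * m)\<^sup>2 / n" using n by simp
  also have "\<dots> = s\<^sup>2 / n - 2 * m * s + n * m\<^sup>2"
    using n by (simp add: field_simps power2_eq_square)
  finally have "(\<Sum>i\<in>V. (f i)\<^sup>2) - s\<^sup>2 / n \<le> (\<Sum>i\<in>V. (f i - m)\<^sup>2)" unfolding shift by simp
  also have "\<dots> = (\<Sum>i\<in>V. (g1 i)\<^sup>2) + (\<Sum>i\<in>V. (g2 i)\<^sup>2)"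
    unfolding sum.distrib[symmetric]
    by (intro sum.cong refl) (auto simp: g1_def g2_def max_def power2_commute)
  finally have "h\<^sup>2 / \<Delta> * ((\<Sum>i\<in>V. (f i)\<^sup>2) - s\<^sup>2 / n) \<le>
      h\<^sup>2 / \<Delta> * (\<Sum>i\<in>V. (g1 i)\<^sup>2) + h\<^sup>2 / \<Delta> * (\<Sum>i\<in>V. (g2 i)\<^sup>2)"
    using \<Delta> by (metis (no_types, lifting) distrib_left less_imp_le divide_nonneg_pos mult_left_mono zero_le_power2)
  also have "\<dots> \<le> (\<Sum>i\<in>V. \<Sum>j\<in>V. a i j * (g1 i - g1 j)\<^sup>2) + (\<Sum>i\<in>V. \<Sum>j\<in>V. a i j * (g2 i - g2 j)\<^sup>2)"
    by (intro add_mono cheeger_small_support)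
       (use V sym a0 cut deg h \<Delta> m supp in \<open>auto simp: g1_def g2_def\<close>)
  also have "\<dots> = (\<Sum>i\<in>V. \<Sum>j\<in>V. a i j * ((g1 i - g1 j)\<^sup>2 + (g2 i - g2 j)\<^sup>2))"
    by (simp add: sum.distrib distrib_left)
  also have "\<dots> \<le> (\<Sum>i\<in>V. \<Sum>j\<in>V. a i j * (f i - f j)\<^sup>2)"
  proof (intro sum_mono mult_left_mono a0)
    fix i j
    have "f i - f j = (g1 i - g1 j) - (g2 i - g2 j)" by (auto simp: g1_def g2_def)
    then have "(f i - f j)\<^sup>2 =
        (g1 i - g1 j)\<^sup>2 + (g2 i - g2 j)\<^sup>2 - 2 * ((g1 i - g1 j) * (g2 i - g2 j))"
      by (simp only: power2_diff)
    moreover have "(g1 i - g1 j) * (g2 i - g2 j) \<le> 0"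
      by (auto simp: g1_def g2_def max_def mult_le_0_iff)
    ultimately show "(g1 i - g1 j)\<^sup>2 + (g2 i - g2 j)\<^sup>2 \<le> (f i - f j)\<^sup>2" by linarith
  qed
  finally show ?thesis by (simp add: s_def n_def)
qed

text \<open>Eigenvectors of a unitary diagonalisation may be complex; both sides are additive over real and
  imaginary parts.\<close>

lemma cheeger_inequality_complex:
  fixes a :: "'a \<Rightarrow> 'a \<Rightarrow> real" and h \<Delta> :: real and x :: "'a \<Rightarrow> complex"
  assumes "finite V" "V \<noteq> {}" "\<And>i j. a i j = a j i" "\<And>i j. 0 \<le> a i j"
    and "\<And>S. S \<subseteq> V \<Longrightarrow> 2 * card S \<le> card V \<Longrightarrow>
               h * real (card S) \<le> (\<Sum>i\<in>S. \<Sum>j\<in>V - S. a i j)"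
    and "\<And>i. i \<in> V \<Longrightarrow> (\<Sum>j\<in>V. a i j) \<le> \<Delta>"
    and "0 < h" "0 < \<Delta>"
  shows "h\<^sup>2 / \<Delta> * ((\<Sum>i\<in>V. (cmod (x i))\<^sup>2) - (cmod (\<Sum>i\<in>V. x i))\<^sup>2 / card V) \<le>
         (\<Sum>i\<in>V. \<Sum>j\<in>V. a i j * (cmod (x i - x j))\<^sup>2)"
  using cheeger_inequality[OF assms, of "\<lambda>i. Re (x i)"] cheeger_inequality[OF assms, of "\<lambda>i. Im (x i)"]
  by (simp add: cmod_power2 sum.distrib distrib_left add_divide_distrib algebra_simps)

section \<open>Cuts and degrees of the random graph\<close>

lemma finite_vertex_pairs: "finite (vertex_pairs n)"
  by (rule finite_subset[of _ "Pow {..<n}"]) (auto simp: vertex_pairs_def)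

lemma set_erdos_renyi: "set_pmf (erdos_renyi n p) \<subseteq> Pow (vertex_pairs n)"
  by (auto simp: erdos_renyi_def)

lemma integrable_erdos_renyi:
  fixes f :: "nat set set \<Rightarrow> real"
  shows "integrable (measure_pmf (erdos_renyi n p)) f"
  using finite_subset[OF set_erdos_renyi] finite_vertex_pairs
  by (intro integrable_measure_pmf_finite) blast

lemma erdos_renyi_mgf:
  assumes p: "0 \<le> p" "p \<le> 1" and F: "F \<subseteq> vertex_pairs n"
  shows "measure_pmf.expectation (erdos_renyi n p) (\<lambda>E. exp (s * real (card (E \<inter> F)))) =
         (1 - p + p * exp s) ^ card F"
proof -
  let ?V = "vertex_pairs n"
  define g where "g = (\<lambda>e b. if e \<in> F \<and> b then exp s else 1 :: real)"
  have "exp (s * real (card ({e \<in> ?V. b e} \<inter> F))) = (\<Prod>e\<in>?V. g e (b e))" for b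
  proof -
    have "(\<Prod>e\<in>?V. g e (b e)) = (\<Prod>e\<in>{e \<in> ?V. b e} \<inter> F. exp s)"
      by (rule prod.mono_neutral_cong_right) (auto simp: g_def finite_vertex_pairs)
    then show ?thesis by (simp add: exp_of_nat_mult[symmetric] mult.commute)
  qed
  then have "measure_pmf.expectation (erdos_renyi n p) (\<lambda>E. exp (s * real (card (E \<inter> F)))) =
      measure_pmf.expectation (Pi_pmf ?V False (\<lambda>_. bernoulli_pmf p)) (\<lambda>b. \<Prod>e\<in>?V. g e (b e))"
    by (simp add: erdos_renyi_def)
  also have "\<dots> = (\<Prod>e\<in>?V. measure_pmf.expectation (bernoulli_pmf p) (g e))"
    by (intro expectation_prod_Pi_pmf finite_vertex_pairs integrable_measure_pmf_finite)
       (auto simp: g_def)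
  also have "\<dots> = (\<Prod>e\<in>F. 1 - p + p * exp s)"
    using p F by (intro prod.mono_neutral_cong_right) (auto simp: g_def finite_vertex_pairs)
  finally show ?thesis by simp
qed

text \<open>The scaling by \<open>s\<close> covers both tails at once: a positive \<open>s\<close> gives the upper tail and a negative
  \<open>s\<close> the lower one.\<close>

lemma erdos_renyi_chernoff:
  assumes p: "0 \<le> p" "p \<le> 1" and F: "F \<subseteq> vertex_pairs n"
  shows "measure_pmf.prob (erdos_renyi n p) {E. s * c \<le> s * real (card (E \<inter> F))} \<le>
         exp (p * real (card F) * (exp s - 1) - s * c)"
proof -
  let ?M = "measure_pmf (erdos_renyi n p)"
  have "{E. s * c \<le> s * real (card (E \<inter> F))} =
        {E \<in> space ?M. exp (s * c) \<le> exp (s * real (card (E \<inter> F)))}" by simp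
  then have "measure ?M {E. s * c \<le> s * real (card (E \<inter> F))} \<le>
      measure_pmf.expectation (erdos_renyi n p) (\<lambda>E. exp (s * real (card (E \<inter> F)))) / exp (s * c)"
    using integral_Markov_inequality_measure[OF integrable_erdos_renyi, of UNIV, of n p
        "\<lambda>E. exp (s * real (card (E \<inter> F)))" "exp (s * c)"] by simp
  also have "\<dots> = (1 + p * (exp s - 1)) ^ card F / exp (s * c)"
    by (simp add: erdos_renyi_mgf[OF p F] algebra_simps)
  also have "\<dots> \<le> exp (p * (exp s - 1)) ^ card F / exp (s * c)"
  proof (intro divide_right_mono power_mono)
    have "0 \<le> 1 - p + p * exp s" using p by (intro add_nonneg_nonneg mult_nonneg_nonneg) auto
    then show "0 \<le> 1 + p * (exp s - 1)" by (simp add: algebra_simps)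
  qed auto
  also have "exp (p * (exp s - 1)) ^ card F = exp (p * real (card F) * (exp s - 1))"
    unfolding exp_of_nat_mult[symmetric] by (simp add: mult_ac)
  also have "\<dots> / exp (s * c) = exp (p * real (card F) * (exp s - 1) - s * c)"
    by (rule exp_diff[symmetric])
  finally show ?thesis .
qed

definition cut_pairs :: "nat \<Rightarrow> nat set \<Rightarrow> nat set set" where
  "cut_pairs n S = {e \<in> vertex_pairs n. \<exists>i\<in>S. \<exists>j\<in>{..<n} - S. e = {i, j}}"

lemma card_edges_between:
  assumes E: "E \<subseteq> vertex_pairs n" and S: "S \<subseteq> {..<n}"
  shows "card (E \<inter> cut_pairs n S) = card {(i, j). i \<in> S \<and> j \<in> {..<n} - S \<and> {i, j} \<in> E}"
proof -
  let ?P = "{(i, j). i \<in> S \<and> j \<in> {..<n} - S \<and> {i, j} \<in> E}"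
  have inj: "inj_on (\<lambda>(i, j). {i, j}) ?P"
    by (auto simp: inj_on_def doubleton_eq_iff)
  have image: "(\<lambda>(i, j). {i, j}) ` ?P = E \<inter> cut_pairs n S"
    using E by (auto simp: cut_pairs_def image_iff)
  show ?thesis unfolding image[symmetric] by (rule card_image[OF inj])
qed

lemma card_cut_pairs:
  assumes S: "S \<subseteq> {..<n}"
  shows "card (cut_pairs n S) = card S * (n - card S)"
proof -
  have "{(i, j). i \<in> S \<and> j \<in> {..<n} - S \<and> {i, j} \<in> vertex_pairs n} = S \<times> ({..<n} - S)"
    using S by (auto simp: vertex_pairs_def card_2_iff)
  moreover have "vertex_pairs n \<inter> cut_pairs n S = cut_pairs n S" by (auto simp: cut_pairs_def)
  moreover have "card ({..<n} - S) = n - card S"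
    using S by (subst card_Diff_subset) (auto intro: finite_subset)
  ultimately show ?thesis
    using card_edges_between[OF subset_refl S] by (simp add: card_cartesian_product)
qed

text \<open>A set of \<open>k \<le> n / 2\<close> vertices has at least \<open>k n / 2\<close> potential boundary edges. Taking \<open>s = - 1\<close>, the
  bound \<open>exp (- 1) \<le> 1 / 2\<close> gives the exponent \<open>- p k n / 4\<close>, half of which pays for the
  threshold. The result is a \<open>k\<close>-th power so that the union bound over all sets becomes a
  binomial sum.\<close>

lemma prob_sparse_cut:
  assumes p: "0 \<le> p" "p \<le> 1" and S: "S \<subseteq> {..<n}" "2 * card S \<le> n"
  shows "measure_pmf.prob (erdos_renyi n p)
           {E. real (card (E \<inter> cut_pairs n S)) \<le> p * n / 8 * card S} \<le> exp (- (p * n / 8)) ^ card S"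
proof -
  let ?F = "cut_pairs n S" and ?k = "real (card S)"
  have F: "?F \<subseteq> vertex_pairs n" by (auto simp: cut_pairs_def)
  have "exp (- 1) \<le> (1/2 :: real)"
    using exp_ge_add_one_self[of 1] by (simp add: exp_minus field_simps)
  then have e: "exp (- 1) - 1 \<le> (- 1/2 :: real)" by simp
  have "real (card ?F) = ?k * (real n - ?k)"
    using S by (simp add: card_cut_pairs of_nat_diff)
  moreover have "?k * (real n / 2) \<le> ?k * (real n - ?k)"
    using S by (intro mult_left_mono) auto
  ultimately have card: "?k * real n / 2 \<le> real (card ?F)" by simp
  have "measure_pmf.prob (erdos_renyi n p) {E. real (card (E \<inter> ?F)) \<le> p * n / 8 * card S} \<le>
      exp (p * real (card ?F) * (exp (- 1) - 1) - (- 1) * (p * n / 8 * card S))"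
    using erdos_renyi_chernoff[OF p F, of "- 1" "p * n / 8 * card S"] by simp
  also have "\<dots> \<le> exp (p * real (card ?F) * (- 1/2) + p * n / 8 * ?k)"
    using mult_left_mono[OF e, of "p * real (card ?F)"] p by simp
  also have "\<dots> \<le> exp (p * (?k * real n / 2) * (- 1/2) + p * n / 8 * ?k)"
    using mult_left_mono[OF card p(1)] by (simp add: algebra_simps)
  also have "\<dots> = exp (- (p * n / 8)) ^ card S"
    by (simp add: exp_of_nat_mult[symmetric] algebra_simps)
  finally show ?thesis .
qed

lemma prob_large_degree:
  assumes p: "0 \<le> p" "p \<le> 1" and i: "i < n"
  shows "measure_pmf.prob (erdos_renyi n p)
           {E. 3 * p * n \<le> real (card (E \<inter> cut_pairs n {i}))} \<le> exp (- (p * n))"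
proof -
  let ?F = "cut_pairs n {i}"
  have F: "?F \<subseteq> vertex_pairs n" by (auto simp: cut_pairs_def)
  have e: "exp 1 - 1 \<le> (2 :: real)" using exp_le by simp
  have "real (card ?F) \<le> n" using i by (subst card_cut_pairs) auto
  then have "p * real (card ?F) * (exp 1 - 1) \<le> p * n * 2"
    using p e by (intro mult_mono) auto
  then have "p * real (card ?F) * (exp 1 - 1) - 3 * p * n \<le> - (p * n)" by simp
  then show ?thesis
    using order_trans[OF erdos_renyi_chernoff[OF p F, of 1 "3 * p * n"]] by simp
qed

text \<open>The parameter \<open>d\<close> stands for the mean degree \<open>p n\<close>. The constants 8 and 3 are what the exponential
  moments at \<open>s = - 1\<close> and \<open>s = 1\<close> yield without optimisation. The boundary of a single vertex is its
  star, so the last clause bounds the degrees.\<close>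

definition expanding :: "nat \<Rightarrow> real \<Rightarrow> nat set set \<Rightarrow> bool" where
  "expanding n d E \<longleftrightarrow> E \<subseteq> vertex_pairs n
     \<and> (\<forall>S\<subseteq>{..<n}. 2 * card S \<le> n \<longrightarrow> d / 8 * real (card S) \<le> real (card (E \<inter> cut_pairs n S)))
     \<and> (\<forall>i<n. real (card (E \<inter> cut_pairs n {i})) \<le> 3 * d)"

lemma sum_power_card_subsets:
  assumes "finite A"
  shows "(\<Sum>S\<in>Pow A. q ^ card S) = (1 + q :: real) ^ card A"
  using prod_add[OF assms, of "\<lambda>_. q" "\<lambda>_. 1"] by (simp add: add.commute)

lemma prob_not_expanding:
  assumes p: "0 \<le> p" "p \<le> 1"
  shows "measure_pmf.prob (erdos_renyi n p) {E. \<not> expanding n (p * n) E} \<le>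
         ((1 + exp (- (p * n / 8))) ^ n - 1) + n * exp (- (p * n))"
proof -
  let ?M = "erdos_renyi n p"
  define \<S> where "\<S> = {S. S \<subseteq> {..<n} \<and> S \<noteq> {} \<and> 2 * card S \<le> n}"
  define A where "A = (\<lambda>S. {E. real (card (E \<inter> cut_pairs n S)) \<le> p * n / 8 * card S})"
  define B where "B = (\<lambda>i. {E. 3 * p * n \<le> real (card (E \<inter> cut_pairs n {i}))})"
  have fin: "finite \<S>" by (rule finite_subset[of _ "Pow {..<n}"]) (auto simp: \<S>_def)
  have "measure_pmf.prob ?M {E. \<not> expanding n (p * n) E} \<le>
        measure_pmf.prob ?M ((\<Union>S\<in>\<S>. A S) \<union> (\<Union>i<n. B i))"
  proof (rule measure_pmf.finite_measure_mono_AE)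
    show "AE E in measure_pmf ?M. E \<in> {E. \<not> expanding n (p * n) E} \<longrightarrow>
            E \<in> (\<Union>S\<in>\<S>. A S) \<union> (\<Union>i<n. B i)"
    proof (rule AE_pmfI, rule impI, rule ccontr)
      fix E assume E: "E \<in> set_pmf ?M" and ne: "E \<in> {E. \<not> expanding n (p * n) E}"
        and "E \<notin> (\<Union>S\<in>\<S>. A S) \<union> (\<Union>i<n. B i)"
      then have nA: "E \<notin> (\<Union>S\<in>\<S>. A S)" and nB: "E \<notin> (\<Union>i<n. B i)" by auto
      have "E \<subseteq> vertex_pairs n" using E set_erdos_renyi by blast
      moreover have "p * n / 8 * card S \<le> card (E \<inter> cut_pairs n S)"
        if "S \<subseteq> {..<n}" "2 * card S \<le> n" for S
      proof (cases "S = {}")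
        case False
        then have "E \<notin> A S" using nA that by (auto simp: \<S>_def)
        then show ?thesis by (simp add: A_def)
      qed simp
      moreover have "card (E \<inter> cut_pairs n {i}) \<le> 3 * (p * n)" if "i < n" for i
      proof -
        have "E \<notin> B i" using nB that by auto
        then show ?thesis by (simp add: B_def)
      qed
      ultimately have "expanding n (p * n) E" unfolding expanding_def by blast
      with ne show False by simp
    qed
  qed auto
  also have "\<dots> \<le> measure_pmf.prob ?M (\<Union>S\<in>\<S>. A S) + measure_pmf.prob ?M (\<Union>i<n. B i)"
    by (intro measure_Un_le) auto
  also have "\<dots> \<le> (\<Sum>S\<in>\<S>. measure_pmf.prob ?M (A S)) + (\<Sum>i<n. measure_pmf.prob ?M (B i))"
    using fin by (intro add_mono measure_pmf.finite_measure_subadditive_finite) auto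
  also have "\<dots> \<le> (\<Sum>S\<in>\<S>. exp (- (p * n / 8)) ^ card S) + (\<Sum>i<n. exp (- (p * n)))"
    unfolding A_def B_def using p
    by (intro add_mono sum_mono prob_sparse_cut prob_large_degree) (auto simp: \<S>_def)
  also have "(\<Sum>S\<in>\<S>. exp (- (p * n / 8)) ^ card S) \<le> (\<Sum>S\<in>Pow {..<n} - {{}}. exp (- (p * n / 8)) ^ card S)"
    by (intro sum_mono2) (auto simp: \<S>_def)
  also have "\<dots> = (1 + exp (- (p * n / 8))) ^ n - 1"
    using sum_power_card_subsets[of "{..<n}" "exp (- (p * n / 8))"] by (simp add: sum_diff1)
  finally show ?thesis by simp
qed

section \<open>The spectral gap of the Laplacian\<close>

definition edge_weight :: "nat set set \<Rightarrow> nat \<Rightarrow> nat \<Rightarrow> real" where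
  "edge_weight E i j = (if {i, j} \<in> E then 1 else 0)"

lemma edge_weight_sym: "edge_weight E i j = edge_weight E j i"
  by (simp add: edge_weight_def insert_commute)

lemma edge_weight_self: "E \<subseteq> vertex_pairs n \<Longrightarrow> edge_weight E i i = 0"
  by (auto simp: edge_weight_def vertex_pairs_def)

lemma laplacian_carrier: "laplacian_mat n E \<in> carrier_mat n n"
  by (rule carrier_matI) (simp_all add: laplacian_mat_def degree_mat_def adjacency_mat_def mat_diag_def)

lemma laplacian_index:
  assumes "i < n" "j < n"
  shows "laplacian_mat n E $$ (i, j) =
    complex_of_real ((if i = j then \<Sum>k<n. edge_weight E i k else 0) - edge_weight E i j)"
proof -
  have count: "real (card {j \<in> {..<n}. {i, j} \<in> E}) = (\<Sum>k<n. edge_weight E i k)"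
    by (simp add: edge_weight_def sum.If_cases Int_def)
  have "of_nat (card {j \<in> {..<n}. {i, j} \<in> E}) = complex_of_real (\<Sum>k<n. edge_weight E i k)"
    unfolding count[symmetric] by simp
  then show ?thesis
    using assms by (cases "i = j")
      (simp_all add: laplacian_mat_def degree_mat_def adjacency_mat_def mat_diag_def edge_weight_def del: of_real_sum)
qed

lemma laplacian_hermitian: "mat_adjoint (laplacian_mat n E) = laplacian_mat n E"
  by (rule eq_matI)
     (use laplacian_carrier[of n E] in \<open>auto simp: laplacian_index edge_weight_sym[of E]\<close>)

lemma laplacian_column_sum:
  assumes "j < n"
  shows "(\<Sum>i<n. laplacian_mat n E $$ (i, j)) = 0"
proof -
  have "(\<Sum>i<n. laplacian_mat n E $$ (i, j)) =
      complex_of_real (\<Sum>i<n. (if i = j then \<Sum>k<n. edge_weight E i k else 0) - edge_weight E i j)"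
    using assms by (simp add: laplacian_index del: of_real_diff)
  also have "(\<Sum>i<n. (if i = j then \<Sum>k<n. edge_weight E i k else 0) - edge_weight E i j) = 0"
    using assms by (simp add: sum_subtractf edge_weight_sym[of E j])
  finally show ?thesis by simp
qed

lemma laplacian_quadratic_form:
  "(\<Sum>i<n. \<Sum>j<n. cnj (x i) * laplacian_mat n E $$ (i, j) * x j) =
   complex_of_real ((\<Sum>i<n. \<Sum>j<n. edge_weight E i j * (cmod (x i - x j))\<^sup>2) / 2)"
proof -
  define a where "a = (\<lambda>i j. complex_of_real (edge_weight E i j))"
  have a_sym: "a i j = a j i" for i j by (simp add: a_def edge_weight_sym)
  define P where "P = (\<Sum>i<n. \<Sum>j<n. a i j * (x i * cnj (x i)))"
  define R where "R = (\<Sum>i<n. \<Sum>j<n. a i j * (cnj (x i) * x j))"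
  have P': "(\<Sum>i<n. \<Sum>j<n. a i j * (x j * cnj (x j))) = P"
    unfolding P_def by (subst sum.swap) (simp add: a_sym)
  have R': "(\<Sum>i<n. \<Sum>j<n. a i j * (x i * cnj (x j))) = R"
    unfolding R_def by (subst sum.swap) (simp add: a_sym mult_ac)
  have "(\<Sum>i<n. \<Sum>j<n. cnj (x i) * laplacian_mat n E $$ (i, j) * x j) =
      (\<Sum>i<n. \<Sum>j<n. (if i = j then cnj (x i) * (\<Sum>k<n. a i k) * x i else 0) - a i j * (cnj (x i) * x j))"
    by (intro sum.cong refl) (auto simp: laplacian_index a_def algebra_simps)
  also have "\<dots> = P - R"
    by (simp add: sum_subtractf P_def R_def sum_distrib_left sum_distrib_right mult_ac)
  also have "\<dots> = (P + P - R - R) / 2" by simp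
  also have "P + P - R - R = (\<Sum>i<n. \<Sum>j<n. a i j * ((x i - x j) * cnj (x i - x j)))"
  proof -
    have "(\<Sum>i<n. \<Sum>j<n. a i j * ((x i - x j) * cnj (x i - x j))) =
        (\<Sum>i<n. \<Sum>j<n. a i j * (x i * cnj (x i)) + a i j * (x j * cnj (x j))
          - a i j * (cnj (x i) * x j) - a i j * (x i * cnj (x j)))"
      by (intro sum.cong refl) (simp add: algebra_simps)
    also have "\<dots> = P + P - R - R"
      unfolding sum_subtractf sum.distrib P' R' by (simp add: P_def R_def)
    finally show ?thesis by simp
  qed
  finally show ?thesis
    by (simp add: a_def complex_norm_square del: of_real_power complex_cnj_diff)
qed

text \<open>This translates between the weighted sums over ordered pairs in Cheeger's inequality and the edge
  counts that the tail bounds control.\<close>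

lemma sum_edge_weight_boundary:
  assumes E: "E \<subseteq> vertex_pairs n" and S: "S \<subseteq> {..<n}"
  shows "(\<Sum>i\<in>S. \<Sum>j\<in>{..<n} - S. edge_weight E i j) = real (card (E \<inter> cut_pairs n S))"
proof -
  have fin: "finite S" using S finite_subset by blast
  have "(\<Sum>i\<in>S. \<Sum>j\<in>{..<n} - S. edge_weight E i j) = (\<Sum>(i, j)\<in>S \<times> ({..<n} - S). edge_weight E i j)"
    by (rule sum.cartesian_product)
  also have "\<dots> = (\<Sum>(i, j)\<in>{(i, j). i \<in> S \<and> j \<in> {..<n} - S \<and> {i, j} \<in> E}. 1)"
    using fin by (intro sum.mono_neutral_cong_right) (auto simp: edge_weight_def split: if_splits)
  finally show ?thesis by (simp add: card_edges_between[OF E S] case_prod_unfold)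
qed

text \<open>Let \<open>c\<^sub>k\<close> be the sum of the entries of the \<open>k\<close>-th eigenvector. Since the columns of the Laplacian
  sum to zero, \<open>c\<^sub>k = 0\<close> unless \<open>\<mu> k = 0\<close>, and Cheeger's inequality gives
  \<open>\<mu> k \<ge> d / 384\<close> whenever \<open>c\<^sub>k = 0\<close>. If \<open>\<mu> k = 0\<close>, the same inequality forces \<open>\<bar>c\<^sub>k\<bar>\<^sup>2 \<ge> n\<close>. By Parseval's
  identity for the all-ones vector the squares \<open>\<bar>c\<^sub>k\<bar>\<^sup>2\<close> add up to \<open>n\<close>, so this happens for exactly one
  \<open>k\<close>.\<close>

lemma laplacian_spectral_gap:
  assumes E: "expanding n d E" and d: "0 < d" and n: "0 < n"
    and L: "spectral_form n (laplacian_mat n E) U \<mu>"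
  obtains k0 where "k0 < n" "\<mu> k0 = 0" "\<And>k. k < n \<Longrightarrow> k \<noteq> k0 \<Longrightarrow> d / 384 \<le> \<mu> k"
proof -
  have EV: "E \<subseteq> vertex_pairs n"
    and cut: "\<And>S. S \<subseteq> {..<n} \<Longrightarrow> 2 * card S \<le> n \<Longrightarrow> d / 8 * real (card S) \<le> real (card (E \<inter> cut_pairs n S))"
    and deg: "\<And>i. i < n \<Longrightarrow> real (card (E \<inter> cut_pairs n {i})) \<le> 3 * d"
    using E by (auto simp: expanding_def)
  define c where "c = (\<lambda>k. \<Sum>i<n. U $$ (i, k))"
  have kernel: "complex_of_real (\<mu> k) * c k = 0" if k: "k < n" for k
  proof -
    have "complex_of_real (\<mu> k) * c k = (\<Sum>i<n. \<Sum>j<n. laplacian_mat n E $$ (i, j) * U $$ (j, k))"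
      using k by (simp add: c_def sum_distrib_left spectral_form_eigenvector[OF L])
    also have "\<dots> = (\<Sum>j<n. (\<Sum>i<n. laplacian_mat n E $$ (i, j)) * U $$ (j, k))"
      by (subst sum.swap) (simp add: sum_distrib_right)
    finally show ?thesis by (simp add: laplacian_column_sum)
  qed
  have unit: "(\<Sum>i<n. (cmod (U $$ (i, k)))\<^sup>2) = 1" if k: "k < n" for k
  proof -
    have "complex_of_real (\<Sum>i<n. (cmod (U $$ (i, k)))\<^sup>2) = (\<Sum>i<n. cnj (U $$ (i, k)) * U $$ (i, k))"
      by (simp add: complex_norm_square mult.commute del: of_real_power)
    also have "\<dots> = 1" using orthonormal_columns[OF L k k] by simp
    finally show ?thesis by (simp only: of_real_eq_1_iff)
  qed
  have rayleigh: "\<mu> k = (\<Sum>i<n. \<Sum>j<n. edge_weight E i j * (cmod (U $$ (i, k) - U $$ (j, k)))\<^sup>2) / 2"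
    if k: "k < n" for k
  proof -
    have "complex_of_real ((\<Sum>i<n. \<Sum>j<n. edge_weight E i j * (cmod (U $$ (i, k) - U $$ (j, k)))\<^sup>2) / 2) =
        (\<Sum>i<n. cnj (U $$ (i, k)) * (\<Sum>j<n. laplacian_mat n E $$ (i, j) * U $$ (j, k)))"
      unfolding laplacian_quadratic_form[symmetric] by (simp add: sum_distrib_left mult.assoc)
    also have "\<dots> = (\<Sum>i<n. cnj (U $$ (i, k)) * (complex_of_real (\<mu> k) * U $$ (i, k)))"
      using k by (simp add: spectral_form_eigenvector[OF L])
    also have "\<dots> = complex_of_real (\<mu> k) * (\<Sum>i<n. cnj (U $$ (i, k)) * U $$ (i, k))"
      by (simp add: sum_distrib_left mult_ac)
    also have "\<dots> = complex_of_real (\<mu> k)" using orthonormal_columns[OF L k k] by simp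
    finally show ?thesis by (simp only: of_real_eq_iff)
  qed
  have gap: "d / 384 * (1 - (cmod (c k))\<^sup>2 / n) \<le> \<mu> k" if k: "k < n" for k
  proof -
    have "(d / 8)\<^sup>2 / (3 * d) * ((\<Sum>i<n. (cmod (U $$ (i, k)))\<^sup>2) - (cmod (\<Sum>i<n. U $$ (i, k)))\<^sup>2 / card {..<n})
        \<le> (\<Sum>i<n. \<Sum>j<n. edge_weight E i j * (cmod (U $$ (i, k) - U $$ (j, k)))\<^sup>2)"
    proof (rule cheeger_inequality_complex)
      show "d / 8 * real (card S) \<le> (\<Sum>i\<in>S. \<Sum>j\<in>{..<n} - S. edge_weight E i j)"
        if "S \<subseteq> {..<n}" "2 * card S \<le> card {..<n}" for S
        using cut[of S] that by (simp add: sum_edge_weight_boundary[OF EV])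
      show "(\<Sum>j\<in>{..<n}. edge_weight E i j) \<le> 3 * d" if "i \<in> {..<n}" for i
      proof -
        have "(\<Sum>j\<in>{..<n}. edge_weight E i j) = (\<Sum>j\<in>{..<n} - {i}. edge_weight E i j)"
          using that by (simp add: sum.remove[of _ i] edge_weight_self[OF EV])
        also have "\<dots> = real (card (E \<inter> cut_pairs n {i}))"
          using sum_edge_weight_boundary[OF EV, of "{i}"] that by simp
        finally show ?thesis using deg[of i] that by simp
      qed
      show "edge_weight E i j = edge_weight E j i" for i j by (rule edge_weight_sym)
      show "0 \<le> edge_weight E i j" for i j by (simp add: edge_weight_def)
    qed (use d n in auto)
    \<comment> \<open>The factor 2 cancels against the Dirichlet form counting each edge twice.\<close>
    moreover have "(d / 8)\<^sup>2 / (3 * d) = 2 * (d / 384)"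
      using d by (simp add: power2_eq_square)
    ultimately show ?thesis
      unfolding rayleigh[OF k] using unit[OF k] by (simp add: c_def)
  qed
  have parseval: "(\<Sum>k<n. (cmod (c k))\<^sup>2) = n"
  proof -
    have "complex_of_real (\<Sum>k<n. (cmod (c k))\<^sup>2) = (\<Sum>k<n. \<Sum>i<n. \<Sum>j<n. U $$ (i, k) * cnj (U $$ (j, k)))"
      by (simp add: complex_norm_square c_def sum_product del: of_real_power)
    also have "\<dots> = (\<Sum>i<n. \<Sum>k<n. \<Sum>j<n. U $$ (i, k) * cnj (U $$ (j, k)))"
      by (rule sum.swap)
    also have "\<dots> = (\<Sum>i<n. \<Sum>j<n. \<Sum>k<n. U $$ (i, k) * cnj (U $$ (j, k)))"
      by (intro sum.cong refl sum.swap)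
    also have "\<dots> = (\<Sum>i<n. \<Sum>j<n. if i = j then 1 else 0)"
      by (intro sum.cong refl) (simp add: orthonormal_rows[OF L])
    also have "\<dots> = complex_of_real (real n)" by simp
    finally show ?thesis by (simp only: of_real_eq_iff)
  qed
  have "\<exists>k<n. c k \<noteq> 0"
  proof (rule ccontr)
    assume "\<not> (\<exists>k<n. c k \<noteq> 0)"
    then have "(\<Sum>k<n. (cmod (c k))\<^sup>2) = 0" by simp
    then show False using parseval n by simp
  qed
  then obtain k0 where k0: "k0 < n" "c k0 \<noteq> 0" by blast
  have zero: "\<mu> k0 = 0" using kernel[OF k0(1)] k0(2) by simp
  have "(1 - (cmod (c k0))\<^sup>2 / n) \<le> 0"
    using gap[OF k0(1)] d by (simp add: zero mult_le_0_iff)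
  then have full: "n \<le> (cmod (c k0))\<^sup>2" using n by (simp add: le_divide_eq)
  have "d / 384 \<le> \<mu> k" if k: "k < n" "k \<noteq> k0" for k
  proof -
    have "(\<Sum>l\<in>{k0, k}. (cmod (c l))\<^sup>2) \<le> (\<Sum>l<n. (cmod (c l))\<^sup>2)"
      using k k0 by (intro sum_mono2) auto
    then have "(cmod (c k0))\<^sup>2 + (cmod (c k))\<^sup>2 \<le> n" using k(2) by (simp add: parseval)
    then have "(cmod (c k))\<^sup>2 \<le> 0" using full by linarith
    then have "c k = 0" by simp
    then show ?thesis using gap[OF k(1)] by simp
  qed
  with k0(1) zero show ?thesis by (rule that)
qed

lemma expanding_entropy_le:
  assumes E: "expanding n d E" and d: "0 < d" and n: "0 < n" and \<tau>: "0 < \<tau>"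
  shows "von_neumann_entropy (gibbs_state \<tau> (laplacian_mat n E)) \<le> 2 * n * exp (- \<tau> * d / 768)"
proof -
  obtain U \<mu> where L: "spectral_form n (laplacian_mat n E) U \<mu>"
    using hermitian_spectral_form[OF laplacian_carrier laplacian_hermitian] by blast
  obtain k0 where "k0 < n" "\<mu> k0 = 0" "\<And>k. k < n \<Longrightarrow> k \<noteq> k0 \<Longrightarrow> d / 384 \<le> \<mu> k"
    using laplacian_spectral_gap[OF E d n L] by blast
  from gibbs_entropy_le[OF L \<tau> this] d show ?thesis by simp
qed

section \<open>Vanishing entropy\<close>

theorem mainTheorem5:
  fixes \<tau> :: real and p :: "nat \<Rightarrow> real"
  assumes "\<tau> > 0"
    and "\<And>n. 0 \<le> p n \<and> p n \<le> 1"
    and "filterlim (\<lambda>n. real n * p n / ln (real n)) at_top sequentially"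
  shows "\<forall>\<epsilon>>0. (\<lambda>n. measure_pmf.prob (erdos_renyi n (p n))
            {E. von_neumann_entropy (gibbs_state \<tau> (laplacian_mat n E)) < \<epsilon>}) \<longlonglongrightarrow> 1"
proof (intro allI impI)
  fix \<epsilon> :: real assume \<epsilon>: "0 < \<epsilon>"
  let ?P = "\<lambda>n. measure_pmf.prob (erdos_renyi n (p n))"
  let ?S = "\<lambda>n. {E. von_neumann_entropy (gibbs_state \<tau> (laplacian_mat n E)) < \<epsilon>}"
  \<comment> \<open>The value 16 makes \<open>exp (- p n / 8)\<close> at most \<open>1 / n\<^sup>2\<close>; the value \<open>1536 / \<tau> = 2 * 768 / \<tau>\<close> does the same for the entropy bound.\<close>
  define K where "K = max 16 (1536 / \<tau>)"
  have K: "16 \<le> K" "1536 \<le> \<tau> * K"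
    using assms(1) by (auto simp: K_def max_def field_simps)
  have "\<forall>\<^sub>F n in sequentially. K \<le> real n * p n / ln (real n)"
    using assms(3) by (simp add: filterlim_at_top)
  moreover have "\<forall>\<^sub>F n in sequentially. 2 \<le> n" by (rule eventually_ge_at_top)
  moreover have "\<forall>\<^sub>F n in sequentially. 2 / real n < \<epsilon>" using \<epsilon> by real_asymp
  ultimately have lower: "\<forall>\<^sub>F n in sequentially. 1 - (exp (1 / real n) - 1 + 1 / real n) \<le> ?P n (?S n)"
  proof eventually_elim
    case (elim n)
    define d where "d = p n * n"
    have ln_pos: "0 < ln (real n)" using elim(2) by simp
    have d: "K * ln n \<le> d" using elim(1) ln_pos by (simp add: d_def le_divide_eq mult.commute)
    have "16 * ln (real n) \<le> K * ln (real n)" using K(1) ln_pos by (intro mult_right_mono) auto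
    then have d16: "16 * ln (real n) \<le> d" using d by linarith
    have "1536 * ln (real n) \<le> \<tau> * K * ln (real n)" using K(2) ln_pos by (intro mult_right_mono) auto
    also have "\<dots> \<le> \<tau> * d" using d assms(1) by simp
    finally have \<tau>d: "1536 * ln (real n) \<le> \<tau> * d" .
    have d0: "0 < d" using d16 ln_pos by linarith
    have square: "exp (- (2 * ln (real n))) = 1 / (real n)\<^sup>2"
      using elim(2) by (simp add: exp_minus exp_double inverse_eq_divide)
    have q1: "exp (- (d / 8)) \<le> 1 / (real n)\<^sup>2" unfolding square[symmetric] using d16 by simp
    have q2: "exp (- d) \<le> 1 / (real n)\<^sup>2" unfolding square[symmetric] using d16 ln_pos by simp
    have q3: "exp (- \<tau> * d / 768) \<le> 1 / (real n)\<^sup>2" unfolding square[symmetric] using \<tau>d by simp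
    have entropy: "E \<in> ?S n" if "expanding n d E" for E
    proof -
      have "von_neumann_entropy (gibbs_state \<tau> (laplacian_mat n E)) \<le> 2 * n * exp (- \<tau> * d / 768)"
        using expanding_entropy_le[OF that d0 _ assms(1)] elim(2) by simp
      also have "\<dots> \<le> 2 * n * (1 / (real n)\<^sup>2)" using q3 by (intro mult_left_mono) auto
      also have "\<dots> = 2 / n" using elim(2) by (simp add: power2_eq_square)
      also have "\<dots> < \<epsilon>" by (rule elim(3))
      finally show ?thesis by simp
    qed
    have "1 - ?P n (?S n) = ?P n (- ?S n)"
      by (subst measure_pmf.prob_compl[of "?S n", simplified, folded Compl_eq_Diff_UNIV]) auto
    also have "\<dots> \<le> ?P n {E. \<not> expanding n d E}"
      using entropy by (intro measure_pmf.finite_measure_mono) auto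
    also have "\<dots> \<le> ((1 + exp (- (d / 8))) ^ n - 1) + n * exp (- d)"
      unfolding d_def using assms(2) by (intro prob_not_expanding) auto
    also have "\<dots> \<le> (exp (1 / n) - 1) + 1 / n"
    proof (intro add_mono diff_mono order_refl)
      have "(1 + exp (- (d / 8))) ^ n \<le> (exp (exp (- (d / 8)))) ^ n"
        by (intro power_mono) auto
      also have "\<dots> = exp (n * exp (- (d / 8)))" by (rule exp_of_nat_mult[symmetric])
      also have "n * exp (- (d / 8)) \<le> n * (1 / (real n)\<^sup>2)"
        using q1 by (intro mult_left_mono) auto
      also have "\<dots> = 1 / n" using elim(2) by (simp add: power2_eq_square)
      finally show "(1 + exp (- (d / 8))) ^ n \<le> exp (1 / n)" by simp
      have "n * exp (- d) \<le> n * (1 / (real n)\<^sup>2)" using q2 by (intro mult_left_mono) auto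
      also have "\<dots> = 1 / n" using elim(2) by (simp add: power2_eq_square)
      finally show "n * exp (- d) \<le> 1 / n" .
    qed
    finally show ?case by linarith
  qed
  show "(\<lambda>n. ?P n (?S n)) \<longlonglongrightarrow> 1"
  proof (rule tendsto_sandwich[OF lower])
    show "(\<lambda>n. 1 - (exp (1 / real n) - 1 + 1 / real n)) \<longlonglongrightarrow> 1" by real_asymp
    show "(\<lambda>n. 1) \<longlonglongrightarrow> (1 :: real)" by simp
  qed simp
qed

end
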